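(* Let $P=P(m_1,\dots,m_{n-1})$ be a natural unit interval order on $[n]$ and let $G=\mathrm{inc}(P)$. Suppose $m_1=r<n$ and $m_{r+1}=n$. Then there is a positive integer $k$ such that $$X_G(\mathbf{x},t)=\sum_{\ell=0}^{k}C_{(n-\ell,\ell)}(t)\,e_{(n-\ell,\ell)},\qquad C_{(n-\ell,\ell)}(t)=\sum_{T\in\overline{\mathcal{T}'}_{P,2^\ell1^{n-2\ell}}}t^{\mathrm{inv}_G(T)},$$ where $\overline{\mathcal{T}'}_{P,2^\ell1^{n-2\ell}}$ is the set of $P$-tableaux $T=[a_{i,j}]$ of shape $2^\ell1^{n-2\ell}$ for which there is no $s\ge \ell+2$ such that $a_{i,1}<_P a_{s,1}$ for all $i\in\{\ell+1,\ell+2,\dots,s-1\}$. Consequently $X_G(\mathbf{x},t)$ is $e$-positive, i.e. each $C_{(n-\ell,\ell)}(t)$ has nonnegative coefficients.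
   Context: A natural unit interval order $P(m_1,\dots,m_{n-1})$ is defined for integers $m_1\le\cdots\le m_{n-1}\le n$ with $m_i\ge i$: it is the poset on $[n]$ with $i<_P j$ iff $i<n$ and $j\in\{m_i+1,\dots,n\}$. Its incomparability graph $\mathrm{inc}(P)$ has vertex set $[n]$ and an edge $\{i,j\}$ ($i<j$) iff $j\le m_i$. The chromatic quasisymmetric function of a graph $G$ on $V\subset\mathbb{P}$ is $X_G(\mathbf{x},t)=\sum_\kappa t^{\mathrm{asc}(\kappa)}\prod_{v}x_{\kappa(v)}$ over proper colorings $\kappa:V\to\mathbb{P}$, with $\mathrm{asc}(\kappa)$ the number of edges $\{i,j\}$, $i<j$, with $\kappa(i)<\kappa(j)$. $e_\lambda=e_{\lambda_1}e_{\lambda_2}\cdots$ is the elementary symmetric function, with $e_{(n,0)}=e_n$. A $P$-tableau of shape $\lambda\vdash n$ is a filling $T=[a_{i,j}]$ of the Young diagram of $\lambda$ (English notation, $a_{i,j}$ in row $i$, column $j$) using each element of $P$ exactly once, such that $a_{i,j}<_P a_{i,j+1}$ for all $i,j$ and $a_{i+1,j}\not<_P a_{i,j}$ for all $i,j$. The shape $2^\ell1^{n-2\ell}$ has $\ell$ rows of length $2$ followed by $n-2\ell$ rows of length $1$. For $G=\mathrm{inc}(P)$ and a $P$-tableau $T$, a $G$-inversion of $T$ is an edge $\{i,j\}$ of $G$ with $i<j$ and $i$ in a lower row than $j$ in $T$; $\mathrm{inv}_G(T)$ is the number of $G$-inversions. *)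

theory Defs
  imports "HOL-Library.FuncSet" "HOL-Computational_Algebra.Polynomial"
begin

text \<open>The natural unit interval order P(m_1,...,m_{n-1}) on [n] = {1..n}, with the
  sequence m given as a function nat => nat (only the values m 1, ..., m (n-1) matter):
  i <_P j iff i < n and j in {m_i+1..n}.\<close>
definition nuio_less :: "(nat \<Rightarrow> nat) \<Rightarrow> nat \<Rightarrow> nat \<Rightarrow> nat \<Rightarrow> bool" where
  "nuio_less m n i j \<longleftrightarrow> i \<in> {1..n} \<and> i < n \<and> j \<in> {m i + 1..n}"

definition inc_edge :: "(nat \<Rightarrow> nat) \<Rightarrow> nat \<Rightarrow> nat \<Rightarrow> nat \<Rightarrow> bool" where
  "inc_edge m n i j \<longleftrightarrow> i \<in> {1..n} \<and> j \<in> {1..n} \<and> i < j \<and> j \<le> m i"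

text \<open>A graph on vertex set V (subset of the positive integers) is given by its edge
  predicate E on ordered pairs (i,j) with i < j. Formal power series in x_1, x_2, ...
  are represented by their coefficient functions: a monomial prod_c x_c^(alpha c) is an
  exponent function alpha :: nat => nat of finite support; coefficients lie in Z[t].\<close>

definition proper_coloring :: "nat set \<Rightarrow> (nat \<Rightarrow> nat \<Rightarrow> bool) \<Rightarrow> (nat \<Rightarrow> nat) \<Rightarrow> bool" where
  "proper_coloring V E \<kappa> \<longleftrightarrow> \<kappa> \<in> V \<rightarrow>\<^sub>E {1..} \<and> (\<forall>i j. E i j \<longrightarrow> \<kappa> i \<noteq> \<kappa> j)"

definition asc :: "(nat \<Rightarrow> nat \<Rightarrow> bool) \<Rightarrow> (nat \<Rightarrow> nat) \<Rightarrow> nat" where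
  "asc E \<kappa> = card {(i, j). E i j \<and> \<kappa> i < \<kappa> j}"

definition colorings_with_content ::
    "nat set \<Rightarrow> (nat \<Rightarrow> nat \<Rightarrow> bool) \<Rightarrow> (nat \<Rightarrow> nat) \<Rightarrow> (nat \<Rightarrow> nat) set" where
  "colorings_with_content V E \<alpha> =
     {\<kappa>. proper_coloring V E \<kappa> \<and> (\<forall>c. card {v \<in> V. \<kappa> v = c} = \<alpha> c)}"

definition chrom_qsym_coeff :: "nat set \<Rightarrow> (nat \<Rightarrow> nat \<Rightarrow> bool) \<Rightarrow> (nat \<Rightarrow> nat) \<Rightarrow> int poly" where
  "chrom_qsym_coeff V E \<alpha> = (\<Sum>\<kappa> \<in> colorings_with_content V E \<alpha>. monom 1 (asc E \<kappa>))"

text \<open>e_k = sum over k-subsets S of the positive integers of prod_{c in S} x_c, and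
  e_lambda = e_{lambda_1} e_{lambda_2} ...; so the coefficient of x^alpha in e_lambda is the
  number of tuples (S_1,...,S_r) of finite sets of positive integers with |S_i| = lambda_i
  and alpha c = #{i. c in S_i} for all c.\<close>
definition e_coeff :: "nat list \<Rightarrow> (nat \<Rightarrow> nat) \<Rightarrow> nat" where
  "e_coeff sh \<alpha> = card {Ss. length Ss = length sh \<and>
      (\<forall>i < length sh. Ss ! i \<subseteq> {1..} \<and> finite (Ss ! i) \<and> card (Ss ! i) = sh ! i) \<and>
      (\<forall>c. \<alpha> c = (\<Sum>i < length sh. of_bool (c \<in> Ss ! i)))}"

text \<open>Young diagram (English notation) of a shape given by its list of row lengths;
  cell (i,j) is row i, column j, both 1-based.\<close>
definition young_cells :: "nat list \<Rightarrow> (nat \<times> nat) set" where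
  "young_cells sh = {(i, j). 1 \<le> i \<and> i \<le> length sh \<and> 1 \<le> j \<and> j \<le> sh ! (i - 1)}"

definition shape_21 :: "nat \<Rightarrow> nat \<Rightarrow> nat list" where
  "shape_21 n l = replicate l 2 @ replicate (n - 2 * l) 1"

definition P_tableau :: "(nat \<Rightarrow> nat) \<Rightarrow> nat \<Rightarrow> nat list \<Rightarrow> (nat \<times> nat \<Rightarrow> nat) \<Rightarrow> bool" where
  "P_tableau m n sh T \<longleftrightarrow>
     T \<in> young_cells sh \<rightarrow>\<^sub>E {1..n} \<and>
     bij_betw T (young_cells sh) {1..n} \<and>
     (\<forall>i j. (i, j) \<in> young_cells sh \<and> (i, j + 1) \<in> young_cells sh \<longrightarrow>
              nuio_less m n (T (i, j)) (T (i, j + 1))) \<and>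
     (\<forall>i j. (i, j) \<in> young_cells sh \<and> (i + 1, j) \<in> young_cells sh \<longrightarrow>
              \<not> nuio_less m n (T (i + 1, j)) (T (i, j)))"

definition inv_G :: "(nat \<Rightarrow> nat) \<Rightarrow> nat \<Rightarrow> nat list \<Rightarrow> (nat \<times> nat \<Rightarrow> nat) \<Rightarrow> nat" where
  "inv_G m n sh T = card {(u, v). inc_edge m n u v \<and>
     (\<exists>i j i' j'. (i, j) \<in> young_cells sh \<and> (i', j') \<in> young_cells sh \<and>
        T (i, j) = u \<and> T (i', j') = v \<and> i' < i)}"

definition tableaux_bar :: "(nat \<Rightarrow> nat) \<Rightarrow> nat \<Rightarrow> nat \<Rightarrow> (nat \<times> nat \<Rightarrow> nat) set" where
  "tableaux_bar m n l = {T. P_tableau m n (shape_21 n l) T \<and>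
     \<not> (\<exists>s. l + 2 \<le> s \<and> s \<le> length (shape_21 n l) \<and>
            (\<forall>i \<in> {l + 1..<s}. nuio_less m n (T (i, 1)) (T (s, 1))))}"

definition C_coeff :: "(nat \<Rightarrow> nat) \<Rightarrow> nat \<Rightarrow> nat \<Rightarrow> int poly" where
  "C_coeff m n l = (\<Sum>T \<in> tableaux_bar m n l. monom 1 (inv_G m n (shape_21 n l) T))"

end

theory Submission
  imports Defs
begin

text \<open>
  Since \<open>m\<^sub>1 = r\<close> and \<open>m\<^bsub>r+1\<^esub> = n\<close>, both \<open>{1..r}\<close> and \<open>{r+1..n}\<close> are cliques of
  the incomparability graph, so chains of \<open>P\<close> have at most two elements. Colorings and tableaux are read
  as permutations of \<open>[n]\<close> by listing color classes from the largest color (rows from the top), each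
  one decreasingly; the statistics then count edges \<open>i < j\<close> with \<open>j\<close> before \<open>i\<close>.

  A local bijection on three consecutive letters exchanges a two-element class with an adjacent
  singleton, so the coefficient of \<open>x\<^sup>\<alpha>\<close> depends only on the number \<open>d\<close> of colors used twice; call
  it \<open>N\<^sub>d\<close>. Let \<open>F\<^sub>l\<close> be the weight of all \<open>P\<close>-tableaux of shape \<open>2\<^sup>l1\<^bsup>n-2l\<^esup>\<close>. Removing the
  column condition cell by cell expresses \<open>F\<^sub>d\<close> through \<open>N\<^sub>d, N\<^bsub>d+1\<^esub>, \<dots>\<close> by the
  recursion of the polynomials \<open>h\<^sub>q(1,y)\<close>. On the other hand \<open>F\<^sub>l = C\<^sub>l + F\<^bsub>l+1\<^esub>\<close>, because
  in a tableau with a forbidden \<open>s\<close> the entry of row \<open>s\<close> can be moved up next to the entry of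
  row \<open>l + 1\<close> without crossing an edge. The triangular system has the unique
  solution \<open>N\<^sub>d = \<Sum>\<^sub>l binom(n-2d, l-d) C\<^sub>l\<close>, and \<open>binom(n-2d, l-d)\<close> is the coefficient
  of \<open>x\<^sup>\<alpha>\<close> in \<open>e\<^bsub>(n-l,l)\<^esub>\<close>.
\<close>

section \<open>Inversions and languages of words\<close>

text \<open>The letter standing first is the second argument of \<open>E\<close>. With
  \<open>E\<close> the edge relation, an inversion is thus an edge whose larger end precedes its
  smaller one.\<close>

fun inv_list :: "('a \<Rightarrow> 'a \<Rightarrow> bool) \<Rightarrow> 'a list \<Rightarrow> nat" where
  "inv_list E [] = 0"
| "inv_list E (x # xs) = length (filter (\<lambda>y. E y x) xs) + inv_list E xs"

lemma inv_list_append: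
  "inv_list E (xs @ ys) =
     inv_list E xs + inv_list E ys + (\<Sum>x\<leftarrow>xs. length (filter (\<lambda>y. E y x) ys))"
  by (induction xs) auto

text \<open>Inversions between a block and its surroundings depend only on the letters of the block,
  not on their order. A local rearrangement therefore has to be checked on the block alone.\<close>

lemma inv_list_cong_mset:
  assumes "mset ys = mset zs" "inv_list E ys = inv_list E zs"
  shows "inv_list E (xs @ ys @ ws) = inv_list E (xs @ zs @ ws)"
proof -
  have len: "length (filter P ys) = length (filter P zs)" for P
    using assms(1) by (metis mset_filter size_mset)
  have sum: "sum_list (map f ys) = sum_list (map f zs)" for f :: "'a \<Rightarrow> nat"
    using assms(1) by (metis mset_map sum_mset_sum_list)
  show ?thesis
    using assms(2) by (simp add: inv_list_append len sum)
qed

text \<open>Asymmetry of \<open>R\<close> makes the letters distinct, so positions can be traded for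
  elements and "before" for \<open>R\<close>. Color words are sorted in this way.\<close>

lemma inv_list_sorted_wrt:
  assumes "sorted_wrt R xs" and asym: "\<And>x y. R x y \<Longrightarrow> \<not> R y x"
  shows "inv_list E xs = card {(u, v). u \<in> set xs \<and> v \<in> set xs \<and> E u v \<and> R v u}"
  using assms(1)
proof (induction xs)
  case Nil
  then show ?case by simp
next
  case (Cons x xs)
  let ?S = "\<lambda>xs. {(u, v). u \<in> set xs \<and> v \<in> set xs \<and> E u v \<and> R v u}"
  have R: "\<And>y. y \<in> set xs \<Longrightarrow> R x y" and "sorted_wrt R xs"
    using Cons.prems by auto
  have irr: "\<not> R y y" for y using asym by blast
  have "distinct xs"
    using \<open>sorted_wrt R xs\<close> irr by (induction xs) auto
  then have "length (filter (\<lambda>y. E y x) xs) = card {y \<in> set xs. E y x}"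
    by (metis distinct_card distinct_filter set_filter)
  also have "\<dots> = card ((\<lambda>y. (y, x)) ` {y \<in> set xs. E y x})"
    by (simp add: card_image inj_on_def)
  finally have 1: "length (filter (\<lambda>y. E y x) xs) = card ((\<lambda>y. (y, x)) ` {y \<in> set xs. E y x})" .
  have "?S (x # xs) = (\<lambda>y. (y, x)) ` {y \<in> set xs. E y x} \<union> ?S xs"
    using R irr asym by auto
  moreover have "((\<lambda>y. (y, x)) ` {y \<in> set xs. E y x}) \<inter> ?S xs = {}"
    using R irr by auto
  moreover have "finite (?S xs)"
    by (rule finite_subset[of _ "set xs \<times> set xs"]) auto
  ultimately show ?case
    using 1 Cons.IH[OF \<open>sorted_wrt R xs\<close>] by (simp add: card_Un_disjoint)
qed

text \<open>The instance where \<open>R\<close> is "occurs before", which distinctness makes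
  asymmetric.\<close>

lemma inv_list_distinct:
  assumes "distinct xs"
  shows "inv_list E xs =
    card {(u, v). E u v \<and> (\<exists>i j. i < j \<and> j < length xs \<and> xs ! i = v \<and> xs ! j = u)}"
proof -
  let ?R = "\<lambda>x y. \<exists>i j. i < j \<and> j < length xs \<and> xs ! i = x \<and> xs ! j = y"
  have "sorted_wrt ?R xs"
    by (auto simp: sorted_wrt_iff_nth_less)
  moreover have "\<not> ?R y x" if R: "?R x y" for x y
  proof
    assume "?R y x"
    then obtain i j where "i < j" "j < length xs" "xs ! i = y" "xs ! j = x" by blast
    moreover obtain i' j' where "i' < j'" "j' < length xs" "xs ! i' = x" "xs ! j' = y"
      using R by blast
    ultimately show False
      using assms nth_eq_iff_index_eq[OF assms, of i j'] nth_eq_iff_index_eq[OF assms, of j i'] by auto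
  qed
  ultimately have "inv_list E xs = card {(u, v). u \<in> set xs \<and> v \<in> set xs \<and> E u v \<and> ?R v u}"
    by (rule inv_list_sorted_wrt)
  also have "{(u, v). u \<in> set xs \<and> v \<in> set xs \<and> E u v \<and> ?R v u} = {(u, v). E u v \<and> ?R v u}"
    by (auto intro!: nth_mem)
  finally show ?thesis .
qed

section \<open>Concatenation of languages\<close>

definition conc :: "'a list set \<Rightarrow> 'a list set \<Rightarrow> 'a list set" (infixr "\<odot>" 75) where
  "A \<odot> B = {xs @ ys | xs ys. xs \<in> A \<and> ys \<in> B}"

definition lang :: "'a list set list \<Rightarrow> 'a list set" where
  "lang As = foldr (\<odot>) As {[]}"

lemma conc_assoc: "(A \<odot> B) \<odot> C = A \<odot> B \<odot> C"
  unfolding conc_def by (simp add: set_eq_iff) (metis append.assoc)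

lemma conc_Nil [simp]: "A \<odot> {[]} = A" "{[]} \<odot> A = A"
  by (auto simp: conc_def)

lemma lang_Nil [simp]: "lang [] = {[]}" and lang_Cons [simp]: "lang (A # As) = A \<odot> lang As"
  by (auto simp: lang_def)

lemma lang_append [simp]: "lang (As @ Bs) = lang As \<odot> lang Bs"
  by (induction As) (auto simp: conc_assoc)

lemma lang_map_iff:
  assumes "distinct cs"
  shows "xs \<in> lang (map A cs) \<longleftrightarrow> (\<exists>\<rho>. (\<forall>c\<in>set cs. \<rho> c \<in> A c) \<and> xs = concat (map \<rho> cs))"
  using assms
proof (induction cs arbitrary: xs)
  case Nil
  then show ?case by simp
next
  case (Cons c cs)
  show ?case
  proof
    assume "xs \<in> lang (map A (c # cs))"
    then obtain y \<rho> where y: "y \<in> A c" "\<forall>c\<in>set cs. \<rho> c \<in> A c" "xs = y @ concat (map \<rho> cs)"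
      using Cons by (auto simp: conc_def)
    \<comment> \<open>The indices are distinct, so assigning a block to \<open>c\<close> leaves the
      blocks of \<open>cs\<close> alone.\<close>
    moreover have "map (\<rho>(c := y)) cs = map \<rho> cs"
      using Cons.prems by auto
    ultimately show "\<exists>\<rho>. (\<forall>c\<in>set (c # cs). \<rho> c \<in> A c) \<and> xs = concat (map \<rho> (c # cs))"
      using Cons.prems by (intro exI[of _ "\<rho>(c := y)"]) auto
  next
    assume "\<exists>\<rho>. (\<forall>c\<in>set (c # cs). \<rho> c \<in> A c) \<and> xs = concat (map \<rho> (c # cs))"
    then obtain \<rho> where "\<forall>c\<in>set (c # cs). \<rho> c \<in> A c" "xs = \<rho> c @ concat (map \<rho> cs)" by auto
    moreover from this have "concat (map \<rho> cs) \<in> lang (map A cs)"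
      using Cons by auto
    ultimately show "xs \<in> lang (map A (c # cs))"
      by (auto simp: conc_def)
  qed
qed

text \<open>A prefix language of constant length makes the factorization unique. This is what keeps
  concatenations of disjoint languages disjoint.\<close>

lemma conc_fixed_length_iff:
  assumes "\<forall>xs\<in>A. length xs = p"
  shows "xs \<in> A \<odot> B \<longleftrightarrow> take p xs \<in> A \<and> drop p xs \<in> B"
proof
  assume "take p xs \<in> A \<and> drop p xs \<in> B"
  then show "xs \<in> A \<odot> B"
    unfolding conc_def using append_take_drop_id[of p xs, symmetric] by blast
qed (use assms in \<open>auto simp: conc_def\<close>)

lemma conc_fixed_length_disjoint:
  assumes "\<forall>xs\<in>A. length xs = p" "\<forall>xs\<in>M1. length xs = q" "\<forall>xs\<in>M2. length xs = q" "M1 \<inter> M2 = {}"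
  shows "(A \<odot> M1 \<odot> B) \<inter> (A \<odot> M2 \<odot> B) = {}"
  using assms(4) by (auto simp: conc_fixed_length_iff[OF assms(1)] conc_fixed_length_iff[OF assms(2)]
      conc_fixed_length_iff[OF assms(3)])

lemma conc_Un: "A \<odot> (M1 \<union> M2) \<odot> B = (A \<odot> M1 \<odot> B) \<union> (A \<odot> M2 \<odot> B)"
  unfolding conc_def by blast

lemma sum_list_12: "set w \<subseteq> {Suc 0, 2} \<Longrightarrow> sum_list w = 2 * count_list w 2 + count_list w (Suc 0)"
  by (induction w) auto

section \<open>The ribbon recursion\<close>

text \<open>The weight of words with \<open>d\<close> two-element chains and one free block of
  length \<open>q\<close> without descents, in terms of the weights \<open>a\<close> of words made
  of chains only. Blocks of length 0 and 1 are chains already.\<close>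

fun ribbon_rec :: "(nat \<Rightarrow> 'a::ab_group_add) \<Rightarrow> nat \<Rightarrow> nat \<Rightarrow> 'a" where
  "ribbon_rec a 0 d = a d"
| "ribbon_rec a (Suc 0) d = a d"
| "ribbon_rec a (Suc (Suc q)) d = ribbon_rec a (Suc q) d - ribbon_rec a q (Suc d)"

text \<open>\<open>ribbon_rec a q d\<close> is \<open>a d\<close> plus a combination of values of
  \<open>a\<close> at larger arguments. The resulting linear system is unitriangular, hence has at
  most one solution.\<close>

lemma ribbon_rec_vanishing:
  assumes "\<And>d'. d' > d \<Longrightarrow> a d' = 0"
  shows "d' > d \<Longrightarrow> ribbon_rec a q d' = 0" and "ribbon_rec a q d = a d"
proof -
  show 1: "ribbon_rec a q d' = 0" if "d' > d" for q d'
    using that assms by (induction q arbitrary: d' rule: induct_nat_012) auto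
  show "ribbon_rec a q d = a d"
  proof (induction q rule: less_induct)
    case (less q)
    then show ?case
      using 1 by (cases "(a, q, d)" rule: ribbon_rec.cases) auto
  qed
qed

lemma ribbon_rec_diff:
  "ribbon_rec (\<lambda>d. a d - b d) q d = ribbon_rec a q d - ribbon_rec b q d"
  by (induction q arbitrary: d rule: induct_nat_012) (auto simp: algebra_simps)

lemma ribbon_rec_sum_smult:
  fixes g :: "'b \<Rightarrow> nat \<Rightarrow> int"
  assumes "finite I"
  shows "ribbon_rec (\<lambda>d. \<Sum>l\<in>I. smult (g l d) (c l)) q d = (\<Sum>l\<in>I. smult (ribbon_rec (g l) q d) (c l))"
  by (induction q arbitrary: d rule: induct_nat_012)
     (auto simp: smult_diff_left sum_subtractf)

text \<open>The complete homogeneous polynomials \<open>h_q(1, y)\<close> obey the recursion with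
  \<open>e_1 = 1 + y\<close> and \<open>e_2 = y\<close>, while \<open>binom(n - 2d, l - d)\<close> is the coefficient
  of \<open>y^l\<close> in \<open>e_2^d e_1^(n - 2d)\<close>.\<close>

definition hpoly :: "nat \<Rightarrow> int poly" where
  "hpoly q = (\<Sum>i\<le>q. monom 1 i)"

lemma coeff_hpoly: "coeff (hpoly q) i = of_bool (i \<le> q)"
  by (auto simp: hpoly_def coeff_sum)

lemma hpoly_Suc_Suc: "hpoly (Suc (Suc q)) = [:1, 1:] * hpoly (Suc q) - [:0, 1:] * hpoly q"
proof (rule poly_eqI)
  fix i
  show "coeff (hpoly (Suc (Suc q))) i = coeff ([:1, 1:] * hpoly (Suc q) - [:0, 1:] * hpoly q) i"
    by (cases i) (auto simp: coeff_hpoly)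
qed

lemma coeff_one_plus_X_power: "coeff ([:1, 1:] ^ p :: int poly) k = int (p choose k)"
proof (induction p arbitrary: k)
  case 0
  then show ?case by (cases k) auto
next
  case (Suc p)
  then show ?case by (cases k) auto
qed

text \<open>The guard is essential: for \<open>d > l\<close>, truncated subtraction would turn the
  lower index into 0 and the value into 1.\<close>

definition shifted_binomial :: "nat \<Rightarrow> nat \<Rightarrow> nat \<Rightarrow> int" where
  "shifted_binomial n l d = (if d \<le> l then int ((n - 2 * d) choose (l - d)) else 0)"

text \<open>At \<open>q = 0\<close> the value is the coefficient of \<open>y^l\<close> in
  \<open>y^d (1 + y)^(n - 2d)\<close>. The recursion trades \<open>q\<close> of the factors
  \<open>1 + y\<close> for \<open>h_q(1, y)\<close>.\<close>

lemma ribbon_rec_binomial_aux: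
  assumes "2 * d + q \<le> n"
  shows "ribbon_rec (shifted_binomial n l) q d =
    coeff (monom 1 d * (hpoly q * [:1, 1:] ^ (n - 2 * d - q))) l"
  using assms
proof (induction q arbitrary: d rule: induct_nat_012)
  case 0
  have "hpoly 0 = 1"
    by (simp add: hpoly_def)
  then show ?case
    by (simp add: shifted_binomial_def coeff_monom_mult coeff_one_plus_X_power)
next
  case 1
  have "hpoly (Suc 0) = [:1, 1:]"
    by (simp add: hpoly_def monom_altdef one_pCons)
  then have "hpoly (Suc 0) * [:1, 1:] ^ (n - 2 * d - Suc 0) = [:1, 1:] ^ (n - 2 * d)"
    using 1 by (cases "n - 2 * d") auto
  then show ?case
    by (simp add: shifted_binomial_def coeff_monom_mult coeff_one_plus_X_power)
next
  case (ge2 q)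
  define s where "s = n - 2 * d - Suc (Suc q)"
  \<comment> \<open>All three terms share the factor \<open>(1 + y)^s\<close>; dividing by it leaves
    the recursion of \<open>hpoly\<close>.\<close>
  have e: "n - 2 * d - Suc q = Suc s" "n - 2 * Suc d - q = s"
    using ge2(3) by (auto simp: s_def)
  have m: "monom 1 (Suc d) = monom (1::int) d * [:0, 1:]"
    by (simp add: monom_altdef)
  have "monom 1 d * (hpoly (Suc (Suc q)) * [:1, 1:] ^ s) =
      monom 1 d * (hpoly (Suc q) * [:1, 1:] ^ Suc s) - monom 1 (Suc d) * (hpoly q * [:1, 1:] ^ s)"
    unfolding hpoly_Suc_Suc m power_Suc by (simp only: algebra_simps)
  then have "coeff (monom 1 d * (hpoly (Suc (Suc q)) * [:1, 1:] ^ s)) l =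
      ribbon_rec (shifted_binomial n l) (Suc q) d - ribbon_rec (shifted_binomial n l) q (Suc d)"
    using ge2(1)[of "Suc d", unfolded e] ge2(2)[of d, unfolded e] ge2(3) by auto
  then show ?case by (simp add: s_def)
qed

text \<open>For \<open>q = n - 2 * d\<close> no factor \<open>1 + y\<close> is left. The polynomial
  is \<open>y^d h_q(1, y)\<close>, with all coefficients 1 in degrees \<open>d\<close> to
  \<open>n - d\<close> and 0 elsewhere.\<close>

lemma ribbon_rec_binomial:
  assumes "2 * d \<le> n" "l + d \<le> n"
  shows "ribbon_rec (shifted_binomial n l) (n - 2 * d) d = of_bool (d \<le> l)"
  using assms by (auto simp: ribbon_rec_binomial_aux coeff_monom_mult coeff_hpoly)

section \<open>Coefficients of elementary symmetric functions\<close>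

lemma e_coeff_pairs:
  "e_coeff [k, l] \<alpha> = card {(S, T). S \<subseteq> {1..} \<and> T \<subseteq> {1..} \<and> finite S \<and> finite T \<and> card S = k \<and> card T = l \<and>
     (\<forall>c. \<alpha> c = of_bool (c \<in> S) + of_bool (c \<in> T))}" (is "_ = card ?P")
proof -
  have "{Ss. length Ss = length [k, l] \<and>
      (\<forall>i < length [k, l]. Ss ! i \<subseteq> {1..} \<and> finite (Ss ! i) \<and> card (Ss ! i) = [k, l] ! i) \<and>
      (\<forall>c. \<alpha> c = (\<Sum>i < length [k, l]. of_bool (c \<in> Ss ! i)))} = (\<lambda>(S, T). [S, T]) ` ?P"
    by (auto simp: length_Suc_conv All_less_Suc2 image_iff)
  moreover have "inj_on (\<lambda>(S, T). [S, T]) ?P"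
    by (auto simp: inj_on_def)
  ultimately show ?thesis
    unfolding e_coeff_def by (simp only: card_image)
qed

lemma e_coeff_nonzeroD:
  assumes "e_coeff [n - l, l] \<alpha> \<noteq> 0" "l \<le> n" "finite {c. \<alpha> c \<noteq> 0}"
  shows "\<alpha> 0 = 0" "\<alpha> c \<le> 2" "(\<Sum>c | \<alpha> c \<noteq> 0. \<alpha> c) = n"
proof -
  obtain S T where ST: "S \<subseteq> {1..}" "T \<subseteq> {1..}" "finite S" "finite T" "card S = n - l" "card T = l"
    and \<alpha>: "\<And>c. \<alpha> c = of_bool (c \<in> S) + of_bool (c \<in> T)"
    using assms(1) unfolding e_coeff_pairs by (auto dest!: card_ge_0_finite simp: card_eq_0_iff)
  have "(\<Sum>c | \<alpha> c \<noteq> 0. \<alpha> c) = (\<Sum>c \<in> S \<union> T. \<alpha> c)"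
    by (rule sum.mono_neutral_cong_left) (use ST in \<open>auto simp: \<alpha>\<close>)
  also have "\<dots> = card S + card T"
  proof -
    have "(S \<union> T) \<inter> {c. c \<in> S} = S" "(S \<union> T) \<inter> {c. c \<in> T} = T" by auto
    then show ?thesis using ST by (simp add: \<alpha> sum.distrib)
  qed
  finally show "(\<Sum>c | \<alpha> c \<noteq> 0. \<alpha> c) = n" using ST assms(2) by simp
  show "\<alpha> 0 = 0" "\<alpha> c \<le> 2" using ST by (auto simp: \<alpha>)
qed

text \<open>A color of exponent 2 lies in both sets, and a color of exponent 1 in exactly one. A
  pair is therefore given by the set \<open>U\<close> of single colors put into \<open>T\<close>;
  the degree condition then forces the size of \<open>S\<close>.\<close>

lemma e_coeff_binomial:
  assumes "\<alpha> 0 = 0" "\<And>c. \<alpha> c \<le> 2" "(\<Sum>c | \<alpha> c \<noteq> 0. \<alpha> c) = n" "finite {c. \<alpha> c \<noteq> 0}" "l \<le> n"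
  shows "int (e_coeff [n - l, l] \<alpha>) = shifted_binomial n l (card {c. \<alpha> c = 2})"
proof -
  define W where "W = {c. \<alpha> c = 2}"
  define Q where "Q = {c. \<alpha> c = 1}"
  let ?P = "{(S, T). S \<subseteq> {1..} \<and> T \<subseteq> {1..} \<and> finite S \<and> finite T \<and> card S = n - l \<and> card T = l \<and>
     (\<forall>c. \<alpha> c = of_bool (c \<in> S) + of_bool (c \<in> T))}"
  have fin: "finite W" "finite Q"
    by (rule finite_subset[OF _ assms(4)]; auto simp: W_def Q_def)+
  have disj: "W \<inter> Q = {}" by (auto simp: W_def Q_def)
  have supp: "{c. \<alpha> c \<noteq> 0} = W \<union> Q"
  proof -
    have "\<alpha> c = 0 \<or> \<alpha> c = 1 \<or> \<alpha> c = 2" for c using assms(2)[of c] by linarith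
    then show ?thesis by (force simp: W_def Q_def)
  qed
  have "n = (\<Sum>c\<in>W. \<alpha> c) + (\<Sum>c\<in>Q. \<alpha> c)"
    using assms(3) unfolding supp by (simp add: sum.union_disjoint fin disj)
  also have "\<dots> = 2 * card W + card Q" by (simp add: W_def Q_def)
  finally have n: "n = 2 * card W + card Q" .
  have pos: "c \<ge> 1" if "c \<in> W \<union> Q" for c
    using that assms(1) unfolding supp[symmetric] by (cases c) auto
  have P: "(S, T) \<in> ?P \<longleftrightarrow> (\<exists>U. U \<subseteq> Q \<and> card W + card U = l \<and> S = W \<union> (Q - U) \<and> T = W \<union> U)" for S T
  proof
    assume "(S, T) \<in> ?P"
    then have ST: "card T = l" and \<alpha>: "\<And>c. \<alpha> c = of_bool (c \<in> S) + of_bool (c \<in> T)" by auto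
    have W: "W = S \<inter> T" and Q: "Q = (S - T) \<union> (T - S)"
      by (auto simp: W_def Q_def \<alpha>)
    have T: "T = W \<union> (T - S)" "S = W \<union> (Q - (T - S))" by (auto simp: W Q)
    have "card (W \<union> (T - S)) = card W + card (T - S)"
      by (rule card_Un_disjoint) (use fin in \<open>auto simp: W Q\<close>)
    then show "\<exists>U. U \<subseteq> Q \<and> card W + card U = l \<and> S = W \<union> (Q - U) \<and> T = W \<union> U"
      using T ST by (intro exI[of _ "T - S"]) (auto simp: Q)
  next
    assume "\<exists>U. U \<subseteq> Q \<and> card W + card U = l \<and> S = W \<union> (Q - U) \<and> T = W \<union> U"
    then obtain U where U: "U \<subseteq> Q" "card W + card U = l" and S: "S = W \<union> (Q - U)" and T: "T = W \<union> U"
      by blast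
    have finU: "finite U" using U(1) fin finite_subset by blast
    have "card T = card W + card U"
      unfolding T by (rule card_Un_disjoint) (use fin finU U disj in auto)
    moreover have "card S = card W + card (Q - U)"
      unfolding S by (rule card_Un_disjoint) (use fin finU U disj in auto)
    moreover have "card (Q - U) = card Q - card U"
      by (rule card_Diff_subset[OF finU U(1)])
    moreover have "card U \<le> card Q" by (rule card_mono[OF fin(2) U(1)])
    moreover have "\<alpha> c = of_bool (c \<in> S) + of_bool (c \<in> T)" for c
    proof -
      have "\<alpha> c = 0 \<or> \<alpha> c = 1 \<or> \<alpha> c = 2" using assms(2)[of c] by linarith
      then show ?thesis using U(1) by (auto simp: S T W_def Q_def)
    qed
    moreover have "S \<subseteq> {1..}" "T \<subseteq> {1..}" using pos U(1) by (auto simp: S T)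
    ultimately show "(S, T) \<in> ?P"
      using U fin finU n by (auto simp: S T)
  qed
  show ?thesis
  proof (cases "card W \<le> l")
    case True
    have "?P = (\<lambda>U. (W \<union> (Q - U), W \<union> U)) ` {U. U \<subseteq> Q \<and> card U = l - card W}"
    proof (rule set_eqI)
      fix x :: "nat set \<times> nat set"
      obtain S T where x: "x = (S, T)" by (cases x)
      show "x \<in> ?P \<longleftrightarrow> x \<in> (\<lambda>U. (W \<union> (Q - U), W \<union> U)) ` {U. U \<subseteq> Q \<and> card U = l - card W}"
        unfolding x P using True by (auto simp: image_iff)
    qed
    moreover have "inj_on (\<lambda>U. (W \<union> (Q - U), W \<union> U)) {U. U \<subseteq> Q \<and> card U = l - card W}"
      using disj by (auto simp: inj_on_def)
    ultimately have "card ?P = card {U. U \<subseteq> Q \<and> card U = l - card W}"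
      by (simp only: card_image)
    also have "\<dots> = card Q choose (l - card W)"
      by (rule n_subsets[OF fin(2)])
    finally have "e_coeff [n - l, l] \<alpha> = card Q choose (l - card W)"
      unfolding e_coeff_pairs .
    then show ?thesis
      using True n unfolding shifted_binomial_def W_def[symmetric] by simp
  next
    case False
    have "(S, T) \<notin> ?P" for S T unfolding P using False by auto
    then have "?P = {}" by auto
    then have "e_coeff [n - l, l] \<alpha> = 0" unfolding e_coeff_pairs by (simp only: card.empty)
    then show ?thesis
      using False unfolding shifted_binomial_def W_def[symmetric] by simp
  qed
qed

lemma distinct_concat_map_unique:
  assumes "distinct (concat (map \<rho> cs))" "distinct cs" "c \<in> set cs" "c' \<in> set cs"
    "v \<in> set (\<rho> c)" "v \<in> set (\<rho> c')"
  shows "c = c'"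
  using assms by (induction cs) auto

section \<open>Cells of two-column shapes\<close>

lemma young_cells_shape_21:
  assumes "2 * l \<le> n"
  shows "(i, j) \<in> young_cells (shape_21 n l) \<longleftrightarrow>
    1 \<le> i \<and> i \<le> l \<and> (j = 1 \<or> j = 2) \<or> l < i \<and> i \<le> n - l \<and> j = 1"
  using assms by (auto simp: young_cells_def shape_21_def nth_append)

text \<open>Rows are read from right to left, so that a row of length two becomes a descent.\<close>

definition cell_pos :: "nat \<Rightarrow> nat \<times> nat \<Rightarrow> nat" where
  "cell_pos l c = (if fst c \<le> l then 2 * (fst c - 1) + (2 - snd c) else l + fst c - 1)"

text \<open>Positions start at 0. Among the first \<open>2 * l\<close>, even positions belong to the
  second column and odd ones to the first.\<close>

definition pos_cell :: "nat \<Rightarrow> nat \<Rightarrow> nat \<times> nat" where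
  "pos_cell l k = (if k < 2 * l then (k div 2 + 1, 2 - k mod 2) else (k - l + 1, 1))"

lemma cell_pos:
  assumes "2 * l \<le> n" "c \<in> young_cells (shape_21 n l)"
  shows "cell_pos l c < n" "pos_cell l (cell_pos l c) = c"
proof -
  obtain i j where c: "c = (i, j)" by (cases c)
  consider "1 \<le> i" "i \<le> l" "j = 1" | "1 \<le> i" "i \<le> l" "j = 2" | "l < i" "i \<le> n - l" "j = 1"
    using assms(2) unfolding c young_cells_shape_21[OF assms(1)] by blast
  then have "cell_pos l c < n \<and> pos_cell l (cell_pos l c) = c"
  proof cases
    case 1
    then obtain i' where "i = Suc i'" by (cases i) auto
    then show ?thesis using 1 assms(1) by (auto simp: c cell_pos_def pos_cell_def)
  next
    case 2
    then obtain i' where "i = Suc i'" by (cases i) auto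
    then show ?thesis using 2 assms(1) by (auto simp: c cell_pos_def pos_cell_def)
  next
    case 3
    then show ?thesis using assms(1) by (auto simp: c cell_pos_def pos_cell_def)
  qed
  then show "cell_pos l c < n" "pos_cell l (cell_pos l c) = c" by auto
qed

lemma pos_cell:
  assumes "2 * l \<le> n" "k < n"
  shows "pos_cell l k \<in> young_cells (shape_21 n l)" "cell_pos l (pos_cell l k) = k"
proof -
  show "pos_cell l k \<in> young_cells (shape_21 n l)"
    unfolding pos_cell_def using assms by (auto simp: young_cells_shape_21[OF assms(1)])
  show "cell_pos l (pos_cell l k) = k"
    unfolding pos_cell_def cell_pos_def using assms by auto
qed

lemma bij_betw_cell_pos:
  assumes "2 * l \<le> n"
  shows "bij_betw (cell_pos l) (young_cells (shape_21 n l)) {..<n}"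
  by (rule bij_betw_byWitness[where f' = "pos_cell l"])
     (use cell_pos[OF assms] pos_cell[OF assms] in auto)

definition fill :: "nat \<Rightarrow> nat \<Rightarrow> nat list \<Rightarrow> nat \<times> nat \<Rightarrow> nat" where
  "fill n l xs = restrict (\<lambda>c. xs ! cell_pos l c) (young_cells (shape_21 n l))"

definition reading :: "nat \<Rightarrow> nat \<Rightarrow> (nat \<times> nat \<Rightarrow> nat) \<Rightarrow> nat list" where
  "reading n l T = map (\<lambda>k. T (pos_cell l k)) [0..<n]"

lemma fill_reading:
  assumes "2 * l \<le> n" "T \<in> extensional (young_cells (shape_21 n l))"
  shows "fill n l (reading n l T) = T"
proof
  fix c
  show "fill n l (reading n l T) c = T c"
    using extensional_arb[OF assms(2), of c] cell_pos[OF assms(1), of c]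
    by (cases "c \<in> young_cells (shape_21 n l)") (simp_all add: fill_def reading_def)
qed

lemma reading_fill:
  assumes "2 * l \<le> n" "length xs = n"
  shows "reading n l (fill n l xs) = xs"
  by (rule nth_equalityI) (use assms pos_cell[OF assms(1)] in \<open>auto simp: fill_def reading_def\<close>)

section \<open>Symmetry\<close>

locale bipartite_nuio =
  fixes m :: "nat \<Rightarrow> nat" and n r :: nat
  assumes nuio: "\<forall>i \<in> {1..n - 1}. i \<le> m i \<and> m i \<le> n"
    and mono: "\<forall>i j. 1 \<le> i \<and> i \<le> j \<and> j \<le> n - 1 \<longrightarrow> m i \<le> m j"
    and m1: "m 1 = r" and rn: "r < n" and mr: "m (r + 1) = n"
begin

abbreviation P_less :: "nat \<Rightarrow> nat \<Rightarrow> bool" (infix "\<prec>" 50) where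
  "x \<prec> y \<equiv> nuio_less m n x y"

abbreviation inv_perm :: "nat list \<Rightarrow> nat" where
  "inv_perm \<equiv> inv_list (inc_edge m n)"

text \<open>By monotonicity \<open>m x\<close> is at least \<open>m 1 = r\<close>, so everything
  above \<open>x\<close> exceeds \<open>r\<close>; and past \<open>r\<close> the value of
  \<open>m\<close> is already \<open>n\<close>, so nothing lies above \<open>x\<close>. All
  relations thus go from \<open>{1..r}\<close> to \<open>{r + 1..n}\<close>.\<close>

lemma P_lessD:
  assumes "x \<prec> y"
  shows "1 \<le> x" "x \<le> r" "r < y" "y \<le> n" "x < y" "m x < y"
proof -
  have x: "1 \<le> x" "x < n" "m x < y" "y \<le> n"
    using assms by (auto simp: nuio_less_def)
  then have "r \<le> m x"
    using mono[rule_format, of 1 x] m1 by simp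
  moreover have "x \<le> r"
  proof (rule ccontr)
    assume "\<not> x \<le> r"
    then have "m (r + 1) \<le> m x"
      using mono x by simp
    then show False using mr x by simp
  qed
  moreover have "x \<le> m x" using nuio x by auto
  ultimately show "1 \<le> x" "x \<le> r" "r < y" "y \<le> n" "x < y" "m x < y"
    using x by auto
qed

lemma not_P_less_chain: "x \<prec> y \<Longrightarrow> \<not> y \<prec> z"
  using P_lessD[of x y] P_lessD[of y z] by auto

lemma P_less_not_edge: "x \<prec> y \<Longrightarrow> \<not> inc_edge m n x y" "x \<prec> y \<Longrightarrow> \<not> inc_edge m n y x"
  using P_lessD[of x y] by (auto simp: inc_edge_def)

lemma edge_iff:
  assumes "x \<in> {1..n}" "y \<in> {1..n}"
  shows "inc_edge m n x y \<longleftrightarrow> x < y \<and> \<not> x \<prec> y"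
  using assms by (auto simp: inc_edge_def nuio_less_def)

section \<open>Languages weighted by inversions of permutations\<close>

definition perms :: "nat list set" where
  "perms = {xs. distinct xs \<and> set xs = {1..n}}"

text \<open>Languages describe only the local shape of a word and allow arbitrary letters. That each
  element of \<open>[n]\<close> occurs once is imposed here, globally, so that languages can be
  plain concatenations.\<close>

definition weight :: "nat list set \<Rightarrow> int poly" where
  "weight L = (\<Sum>xs \<in> L \<inter> perms. monom 1 (inv_perm xs))"

lemma length_perms: "xs \<in> perms \<Longrightarrow> length xs = n"
  unfolding perms_def using distinct_card by fastforce

lemma finite_perms: "finite perms"
proof (rule finite_subset)
  show "perms \<subseteq> {xs. set xs \<subseteq> {1..n} \<and> length xs = n}"
    using length_perms by (auto simp: perms_def)
qed (simp add: finite_lists_length_eq)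

lemma weight_union:
  assumes "A \<inter> B = {}"
  shows "weight (A \<union> B) = weight A + weight B"
proof -
  have "(A \<union> B) \<inter> perms = (A \<inter> perms) \<union> (B \<inter> perms)" by auto
  moreover have "(A \<inter> perms) \<inter> (B \<inter> perms) = {}" using assms by auto
  ultimately show ?thesis
    unfolding weight_def by (simp add: sum.union_disjoint finite_perms)
qed

lemma weight_length_neq:
  assumes "\<And>xs. xs \<in> L \<Longrightarrow> length xs \<noteq> n"
  shows "weight L = 0"
proof -
  have "L \<inter> perms = {}" using assms length_perms by auto
  then show ?thesis by (simp add: weight_def)
qed

text \<open>The fixed length of the prefix locates the middle block, so a bijection of blocks acts
  on whole words. Equal multisets keep the word a permutation and preserve the inversions with the
  rest.\<close>

lemma weight_local_bij:
  assumes lenA: "\<forall>xs\<in>A. length xs = p" and len: "\<forall>xs\<in>M1. length xs = q" "\<forall>xs\<in>M2. length xs = q"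
    and 1: "\<And>y. y \<in> M1 \<Longrightarrow> distinct y \<Longrightarrow> set y \<subseteq> {1..n} \<Longrightarrow>
      \<phi> y \<in> M2 \<and> \<psi> (\<phi> y) = y \<and> mset (\<phi> y) = mset y \<and> inv_perm (\<phi> y) = inv_perm y"
    and 2: "\<And>y. y \<in> M2 \<Longrightarrow> distinct y \<Longrightarrow> set y \<subseteq> {1..n} \<Longrightarrow>
      \<psi> y \<in> M1 \<and> \<phi> (\<psi> y) = y \<and> mset (\<psi> y) = mset y"
  shows "weight (A \<odot> M1 \<odot> B) = weight (A \<odot> M2 \<odot> B)"
proof -
  define app where "app f xs = take p xs @ f (take q (drop p xs)) @ drop q (drop p xs)"
    for f and xs :: "nat list"
  have app: "app f (x @ y @ z) = x @ f y @ z" if "x \<in> A" "length y = q" for f x y z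
    using that lenA by (auto simp: app_def)
  have perm: "x @ y' @ z \<in> perms \<longleftrightarrow> x @ y @ z \<in> perms" if "mset y' = mset y" for x y y' z
    using that by (auto simp: perms_def set_mset_mset[symmetric] dest: mset_eq_imp_distinct_iff
        simp del: set_mset_mset)
  have part: "distinct y \<and> set y \<subseteq> {1..n}" if "x @ y @ z \<in> perms" for x y z
    using that by (auto simp: perms_def)
  have mem: "\<exists>x y z. xs = x @ y @ z \<and> x \<in> A \<and> y \<in> M \<and> z \<in> B" if "xs \<in> A \<odot> M \<odot> B" for xs M
    using that by (auto simp: conc_def)
  have memI: "x @ y @ z \<in> A \<odot> M \<odot> B" if "x \<in> A" "y \<in> M" "z \<in> B" for x y z M
    using that by (auto simp: conc_def)
  show ?thesis
    unfolding weight_def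
  proof (rule sum.reindex_bij_witness[where i = "app \<psi>" and j = "app \<phi>"])
    fix xs assume xs: "xs \<in> (A \<odot> M1 \<odot> B) \<inter> perms"
    then obtain x y z where *: "xs = x @ y @ z" "x \<in> A" "y \<in> M1" "z \<in> B" using mem by blast
    have y: "\<phi> y \<in> M2 \<and> \<psi> (\<phi> y) = y \<and> mset (\<phi> y) = mset y \<and> inv_perm (\<phi> y) = inv_perm y"
      using 1[OF *(3)] part[of x y z] xs * by blast
    show "app \<psi> (app \<phi> xs) = xs" "app \<phi> xs \<in> (A \<odot> M2 \<odot> B) \<inter> perms"
        "monom 1 (inv_perm (app \<phi> xs)) = monom 1 (inv_perm xs)"
      using * y len app perm[of "\<phi> y" y x z] memI xs inv_list_cong_mset[of "\<phi> y" y _ x z]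
      by auto
  next
    fix xs assume xs: "xs \<in> (A \<odot> M2 \<odot> B) \<inter> perms"
    then obtain x y z where *: "xs = x @ y @ z" "x \<in> A" "y \<in> M2" "z \<in> B" using mem by blast
    have y: "\<psi> y \<in> M1 \<and> \<phi> (\<psi> y) = y \<and> mset (\<psi> y) = mset y"
      using 2[OF *(3)] part[of x y z] xs * by blast
    show "app \<phi> (app \<psi> xs) = xs" "app \<psi> xs \<in> (A \<odot> M1 \<odot> B) \<inter> perms"
      using * y len app perm[of "\<psi> y" y x z] memI xs by auto
  qed
qed

section \<open>Chains, and the exchange of a pair with a singleton\<close>

definition pchains :: "nat \<Rightarrow> nat list set" where
  "pchains k = {xs. length xs = k \<and> sorted_wrt (\<lambda>x y. y \<prec> x) xs}"

text \<open>The column condition on consecutive rows of length one.\<close>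

definition descent_free :: "nat \<Rightarrow> nat list set" where
  "descent_free q = {xs. length xs = q \<and> successively (\<lambda>x y. \<not> y \<prec> x) xs}"

lemma pchains_0 [simp]: "pchains 0 = {[]}"
  and pchains_1: "pchains (Suc 0) = {[x] | x. True}"
  and pchains_2: "pchains 2 = {[b, a] | a b. a \<prec> b}"
  by (auto simp: pchains_def length_Suc_conv numeral_2_eq_2)

lemma pchains_ge_3: "k \<ge> 3 \<Longrightarrow> pchains k = {}"
  using not_P_less_chain by (auto simp: pchains_def numeral_3_eq_3 Suc_le_length_iff)

lemma descent_free_0_1 [simp]: "descent_free 0 = pchains 0" "descent_free (Suc 0) = pchains (Suc 0)"
  by (auto simp: pchains_def descent_free_def length_Suc_conv)

lemma length_lang_chains: "xs \<in> lang (map pchains u) \<Longrightarrow> length xs = sum_list u"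
  by (induction u arbitrary: xs) (auto simp: conc_def pchains_def)

text \<open>If \<open>a \<prec> b\<close> is the only relation in the triple, then \<open>a < x < b\<close>, so moving \<open>x\<close> across
  both trades one inversion for another.\<close>

definition pair_right :: "nat list \<Rightarrow> nat list" where
  "pair_right ys = (case ys of [b, a, x] \<Rightarrow>
     if x \<prec> b then [a, b, x] else if a \<prec> x then [b, x, a] else [x, b, a] | _ \<Rightarrow> ys)"

definition pair_left :: "nat list \<Rightarrow> nat list" where
  "pair_left ys = (case ys of [x, b, a] \<Rightarrow>
     if a \<prec> x then [x, a, b] else if x \<prec> b then [b, x, a] else [b, a, x] | _ \<Rightarrow> ys)"

text \<open>If \<open>x \<le> r\<close>, then \<open>m a < b \<le> m x\<close>, and monotonicity of
  \<open>m\<close> gives \<open>a < x\<close>. If \<open>x > r\<close>, then incomparability with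
  \<open>a\<close> gives \<open>x \<le> m a < b\<close>. The other inequality holds because
  \<open>a \<le> r < b\<close>.\<close>

lemma incomparable_between:
  assumes "a \<prec> b" "\<not> x \<prec> b" "\<not> a \<prec> x" "x \<in> {1..n}" "x \<noteq> a" "x \<noteq> b"
  shows "a < x" "x < b"
proof -
  note ab = P_lessD[OF assms(1)]
  have "a < x \<and> x < b"
  proof (cases "x \<le> r")
    case True
    then have xn: "x \<le> n - 1" "1 \<le> x" using ab assms by auto
    then have "b \<le> m x" using assms(2) ab True by (auto simp: nuio_less_def)
    then have "\<not> m x \<le> m a" using ab by simp
    then have "\<not> x \<le> a"
      using mono[rule_format, of x a] xn ab rn by linarith
    then show ?thesis using True ab by simp
  next
    case False
    then have "x \<le> m a" using assms(3,4) ab rn by (auto simp: nuio_less_def)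
    then show ?thesis using False ab by simp
  qed
  then show "a < x" "x < b" by auto
qed

text \<open>The letter \<open>x\<close> cannot be both below \<open>b\<close> and above
  \<open>a\<close>. If it is related to one of them, transposing two comparable letters regroups the
  triple and crosses no edge. Otherwise \<open>x\<close> jumps over the pair, losing the inversion
  with \<open>b\<close> and gaining the one with \<open>a\<close>.\<close>

lemma weight_swap:
  assumes "\<forall>xs\<in>A. length xs = p"
  shows "weight (A \<odot> (pchains 2 \<odot> pchains (Suc 0)) \<odot> B) = weight (A \<odot> (pchains (Suc 0) \<odot> pchains 2) \<odot> B)"
proof (rule weight_local_bij[where \<phi> = pair_right and \<psi> = pair_left and q = 3, OF assms])
  have concI: "xs @ ys \<in> A \<odot> B" if "xs \<in> A" "ys \<in> B" for xs ys :: "nat list" and A B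
    using that by (auto simp: conc_def)
  have "[b, a, x] \<in> pchains 2 \<odot> pchains (Suc 0)" if "a \<prec> b" for a b x
    using concI[of "[b, a]" "pchains 2" "[x]" "pchains (Suc 0)"] that by (simp add: pchains_1 pchains_2)
  then have 21: "pchains 2 \<odot> pchains (Suc 0) = {[b, a, x] | a b x. a \<prec> b}"
    by (auto simp: pchains_1 pchains_2 conc_def)
  have "[x, b, a] \<in> pchains (Suc 0) \<odot> pchains 2" if "a \<prec> b" for a b x
    using concI[of "[x]" "pchains (Suc 0)" "[b, a]" "pchains 2"] that by (simp add: pchains_1 pchains_2)
  then have 12: "pchains (Suc 0) \<odot> pchains 2 = {[x, b, a] | a b x. a \<prec> b}"
    by (auto simp: pchains_1 pchains_2 conc_def)
  show "\<forall>xs\<in>pchains 2 \<odot> pchains (Suc 0). length xs = 3" "\<forall>xs\<in>pchains (Suc 0) \<odot> pchains 2. length xs = 3"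
    by (auto simp: 21 12)
  fix y assume d: "distinct y" "set y \<subseteq> {1..n}"
  {
    assume "y \<in> pchains 2 \<odot> pchains (Suc 0)"
    then obtain a b x where y: "y = [b, a, x]" "a \<prec> b" by (auto simp: 21)
    have "\<not> x \<prec> a"
      using P_lessD[OF y(2)] P_lessD[of x a] by linarith
    consider "x \<prec> b" | "\<not> x \<prec> b" "a \<prec> x" | "\<not> x \<prec> b" "\<not> a \<prec> x" by blast
    then show "pair_right y \<in> pchains (Suc 0) \<odot> pchains 2 \<and> pair_left (pair_right y) = y \<and>
      mset (pair_right y) = mset y \<and> inv_perm (pair_right y) = inv_perm y"
    proof cases
      case 1
      then show ?thesis
        using y \<open>\<not> x \<prec> a\<close> P_less_not_edge[of a b]
        by (simp add: pair_right_def pair_left_def 12)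
    next
      case 2
      then show ?thesis
        using y P_less_not_edge[of a x]
        by (simp add: pair_right_def pair_left_def 12)
    next
      case 3
      then have "a < x" "x < b"
        using incomparable_between[of a b x] y d by auto
      then have "inc_edge m n a x" "inc_edge m n x b" "\<not> inc_edge m n x a" "\<not> inc_edge m n b x"
        using d y 3 edge_iff by auto
      then show ?thesis
        using 3 y by (simp add: pair_right_def pair_left_def 12)
    qed
  }
  {
    assume "y \<in> pchains (Suc 0) \<odot> pchains 2"
    then obtain a b x where y: "y = [x, b, a]" "a \<prec> b" by (auto simp: 12)
    have "\<not> b \<prec> x"
      using y(2) by (rule not_P_less_chain)
    then show "pair_left y \<in> pchains 2 \<odot> pchains (Suc 0) \<and> pair_right (pair_left y) = y \<and>
        mset (pair_left y) = mset y"
      using y by (simp add: pair_right_def pair_left_def 21)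
  }
qed

lemma weight_swap_word:
  "weight (lang (map pchains (u @ 2 # Suc 0 # v))) = weight (lang (map pchains (u @ Suc 0 # 2 # v)))"
  using weight_swap[of "lang (map pchains u)" "sum_list u" "lang (map pchains v)"] length_lang_chains
  by (simp add: conc_assoc)

lemma weight_move_singleton:
  "weight (lang (map pchains (u @ Suc 0 # replicate d 2 @ v))) =
   weight (lang (map pchains (u @ replicate d 2 @ Suc 0 # v)))"
proof (induction d arbitrary: u)
  case 0
  then show ?case by simp
next
  case (Suc d)
  show ?case
    using weight_swap_word[of u "replicate d 2 @ v"] Suc[of "u @ [2]"] by simp
qed

lemma weight_sort_word:
  assumes "set w \<subseteq> {Suc 0, 2}"
  shows "weight (lang (map pchains (u @ w))) = weight (lang (map pchains
    (u @ replicate (count_list w 2) 2 @ replicate (count_list w (Suc 0)) (Suc 0))))"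
  using assms
proof (induction w arbitrary: u)
  case Nil
  then show ?case by simp
next
  case (Cons x w)
  consider "x = 2" | "x = Suc 0" using Cons.prems by auto
  then show ?case
  proof cases
    case 1
    then show ?thesis using Cons.IH[of "u @ [2]"] Cons.prems by simp
  next
    case 2
    then show ?thesis
      using Cons.IH[of "u @ [Suc 0]"] Cons.prems
        weight_move_singleton[of u "count_list w 2" "replicate (count_list w (Suc 0)) (Suc 0)"]
      by simp
  qed
qed

text \<open>This is \<open>N\<^sub>d\<close> of the outline. For \<open>2 * d > n\<close> the words
  are too long to be permutations, and the weight is 0.\<close>

definition pair_weight :: "nat \<Rightarrow> int poly" where
  "pair_weight d = weight (lang (map pchains (replicate d 2 @ replicate (n - 2 * d) (Suc 0))))"

text \<open>Adjacent exchanges sort the block lengths, so their order does not matter. This is the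
  symmetry of the chromatic quasisymmetric function.\<close>

lemma weight_word:
  assumes "set w \<subseteq> {Suc 0, 2}" "sum_list w = n"
  shows "weight (lang (map pchains w)) = pair_weight (count_list w 2)"
proof -
  have "count_list w (Suc 0) = n - 2 * count_list w 2"
    using sum_list_12[OF assms(1)] assms(2) by simp
  then show ?thesis
    using weight_sort_word[OF assms(1), of "[]"] by (simp add: pair_weight_def)
qed

lemma pair_weight_zero:
  assumes "n < 2 * d"
  shows "pair_weight d = 0"
  unfolding pair_weight_def
  by (rule weight_length_neq, drule length_lang_chains) (use assms in \<open>simp add: sum_list_replicate\<close>)

section \<open>Descent-free words\<close>

text \<open>After a letter is appended to a nonempty word without descents, the last two letters
  either extend that word or form a two-element chain.\<close>

lemma descent_free_snoc:
  "descent_free (Suc q) \<odot> pchains (Suc 0) = descent_free (Suc (Suc q)) \<union> descent_free q \<odot> pchains 2"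
  and descent_free_snoc_disjoint: "descent_free (Suc (Suc q)) \<inter> (descent_free q \<odot> pchains 2) = {}"
proof -
  have len: "\<forall>xs\<in>descent_free k. length xs = k" for k
    by (simp add: descent_free_def)
  let ?s = "successively (\<lambda>x y. \<not> y \<prec> x)"
  have *: "(xs \<in> descent_free (Suc q) \<odot> pchains (Suc 0) \<longleftrightarrow>
       xs \<in> descent_free (Suc (Suc q)) \<or> xs \<in> descent_free q \<odot> pchains 2) \<and>
      \<not> (xs \<in> descent_free (Suc (Suc q)) \<and> xs \<in> descent_free q \<odot> pchains 2)"
    if l: "length xs = Suc (Suc q)" for xs
  proof -
    obtain ys z where yz: "xs = ys @ [z]" "length ys = Suc q"
      using l by (metis length_Suc_conv_rev)
    then obtain zs y where zs: "ys = zs @ [y]" "length zs = q"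
      by (metis length_Suc_conv_rev)
    have xs: "xs = zs @ [y, z]" using yz zs by simp
    have 1: "xs \<in> descent_free (Suc q) \<odot> pchains (Suc 0) \<longleftrightarrow> ?s (zs @ [y])"
      using zs unfolding conc_fixed_length_iff[OF len] xs by (simp add: pchains_1 descent_free_def)
    have 2: "xs \<in> descent_free q \<odot> pchains 2 \<longleftrightarrow> ?s zs \<and> z \<prec> y"
      using zs unfolding conc_fixed_length_iff[OF len] xs by (simp add: pchains_2 descent_free_def)
    have 3: "xs \<in> descent_free (Suc (Suc q)) \<longleftrightarrow> ?s (zs @ [y]) \<and> \<not> z \<prec> y"
      using zs by (auto simp: xs descent_free_def successively_append_iff)
    \<comment> \<open>An upper element \<open>y\<close> is below nothing, so no descent can arise
      where \<open>y\<close> meets \<open>zs\<close>.\<close>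
    have "?s (zs @ [y])" if "z \<prec> y" "?s zs"
      using that not_P_less_chain[OF that(1)] by (simp add: successively_append_iff)
    moreover have "?s (zs @ [y]) \<Longrightarrow> ?s zs"
      by (simp add: successively_append_iff)
    ultimately show ?thesis unfolding 1 2 3 by blast
  qed
  have len': "length xs = Suc (Suc q)" if "xs \<in> descent_free (Suc q) \<odot> pchains (Suc 0) \<or>
      xs \<in> descent_free (Suc (Suc q)) \<or> xs \<in> descent_free q \<odot> pchains 2" for xs
    using that by (auto simp: conc_def descent_free_def pchains_def)
  show "descent_free (Suc q) \<odot> pchains (Suc 0) = descent_free (Suc (Suc q)) \<union> descent_free q \<odot> pchains 2"
    using * len' by blast
  show "descent_free (Suc (Suc q)) \<inter> (descent_free q \<odot> pchains 2) = {}"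
    using * len' by blast
qed

lemma weight_ribbon_step:
  assumes "\<forall>xs\<in>A. length xs = p"
  shows "weight (A \<odot> descent_free (Suc (Suc q)) \<odot> B) =
    weight (A \<odot> descent_free (Suc q) \<odot> pchains (Suc 0) \<odot> B) - weight (A \<odot> descent_free q \<odot> pchains 2 \<odot> B)"
proof -
  have "A \<odot> descent_free (Suc q) \<odot> pchains (Suc 0) \<odot> B =
      A \<odot> (descent_free (Suc q) \<odot> pchains (Suc 0)) \<odot> B"
    by (simp add: conc_assoc)
  also have "\<dots> = (A \<odot> descent_free (Suc (Suc q)) \<odot> B) \<union> (A \<odot> (descent_free q \<odot> pchains 2) \<odot> B)"
    by (simp only: descent_free_snoc conc_Un)
  finally have eq: "A \<odot> descent_free (Suc q) \<odot> pchains (Suc 0) \<odot> B =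
      (A \<odot> descent_free (Suc (Suc q)) \<odot> B) \<union> (A \<odot> (descent_free q \<odot> pchains 2) \<odot> B)" .
  have "(A \<odot> descent_free (Suc (Suc q)) \<odot> B) \<inter> (A \<odot> (descent_free q \<odot> pchains 2) \<odot> B) = {}"
    by (rule conc_fixed_length_disjoint[OF assms, where q = "Suc (Suc q)"])
       (use descent_free_snoc_disjoint in \<open>auto simp: conc_def descent_free_def pchains_def\<close>)
  from weight_union[OF this] have "weight (A \<odot> descent_free (Suc q) \<odot> pchains (Suc 0) \<odot> B) =
      weight (A \<odot> descent_free (Suc (Suc q)) \<odot> B) + weight (A \<odot> (descent_free q \<odot> pchains 2) \<odot> B)"
    unfolding eq .
  then show ?thesis by (simp add: conc_assoc)
qed

text \<open>Letters are split off the right end of the block and join \<open>v\<close> as a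
  singleton or a pair. By symmetry only the total number of pairs is recorded.\<close>

lemma weight_ribbon:
  assumes "set u \<subseteq> {Suc 0, 2}" "set v \<subseteq> {Suc 0, 2}" "sum_list u + q + sum_list v = n"
  shows "weight (lang (map pchains u) \<odot> descent_free q \<odot> lang (map pchains v)) =
    ribbon_rec pair_weight q (count_list u 2 + count_list v 2)"
  using assms
proof (induction q arbitrary: v rule: induct_nat_012)
  case 0
  then show ?case
    using weight_word[of "u @ v"] by simp
next
  case 1
  then show ?case
    using weight_word[of "u @ Suc 0 # v"] by simp
next
  case (ge2 q)
  have "weight (lang (map pchains u) \<odot> descent_free (Suc (Suc q)) \<odot> lang (map pchains v)) =
      weight (lang (map pchains u) \<odot> descent_free (Suc q) \<odot> lang (map pchains (Suc 0 # v))) -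
      weight (lang (map pchains u) \<odot> descent_free q \<odot> lang (map pchains (2 # v)))"
    using weight_ribbon_step[of "lang (map pchains u)" "sum_list u"] length_lang_chains by simp
  then show ?case
    using ge2.IH(1)[of "2 # v"] ge2.IH(2)[of "Suc 0 # v"] ge2.prems by simp
qed

text \<open>This is \<open>F\<^sub>l\<close> of the outline. Rows of length two need no column
  condition, since it holds automatically there.\<close>

definition tableau_weight :: "nat \<Rightarrow> int poly" where
  "tableau_weight l = weight (lang (replicate l (pchains 2)) \<odot> descent_free (n - 2 * l))"

lemma tableau_weight_ribbon:
  assumes "2 * d \<le> n"
  shows "tableau_weight d = ribbon_rec pair_weight (n - 2 * d) d"
proof -
  have "count_list (replicate d (2 :: nat)) 2 = d" by (induction d) auto
  then show ?thesis
    using weight_ribbon[of "replicate d 2" "[]" "n - 2 * d"] assms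
    by (simp add: tableau_weight_def sum_list_replicate set_replicate_conv_if)
qed

section \<open>The forbidden rows and their removal\<close>

definition dominated :: "nat list \<Rightarrow> bool" where
  "dominated w \<longleftrightarrow> (\<exists>s. 1 \<le> s \<and> s < length w \<and> (\<forall>i<s. w ! i \<prec> w ! s))"

text \<open>The word form of \<open>C_coeff\<close>.\<close>

definition bar_weight :: "nat \<Rightarrow> int poly" where
  "bar_weight l = weight (lang (replicate l (pchains 2)) \<odot> {w \<in> descent_free (n - 2 * l). \<not> dominated w})"

lemma dominated_iff: "dominated w \<longleftrightarrow> (\<exists>u b v. w = u @ b # v \<and> u \<noteq> [] \<and> (\<forall>x\<in>set u. x \<prec> b))"
proof
  assume "dominated w"
  then obtain s where "1 \<le> s" "s < length w" "\<forall>i<s. w ! i \<prec> w ! s"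
    unfolding dominated_def by blast
  then show "\<exists>u b v. w = u @ b # v \<and> u \<noteq> [] \<and> (\<forall>x\<in>set u. x \<prec> b)"
    by (intro exI[of _ "take s w"] exI[of _ "w ! s"] exI[of _ "drop (Suc s) w"])
       (auto simp: id_take_nth_drop[symmetric] in_set_conv_nth)
next
  assume "\<exists>u b v. w = u @ b # v \<and> u \<noteq> [] \<and> (\<forall>x\<in>set u. x \<prec> b)"
  then obtain u b v where "w = u @ b # v" "u \<noteq> []" "\<forall>x\<in>set u. x \<prec> b" by blast
  then show "dominated w"
    unfolding dominated_def
    by (intro exI[of _ "length u"]) (auto simp: nth_append Suc_le_eq)
qed

text \<open>In a dominated word the dominating letter is the first one above \<open>r\<close>.\<close>

definition raise :: "nat list \<Rightarrow> nat list" where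
  "raise w = (case dropWhile (\<lambda>x. x \<le> r) w of b # v \<Rightarrow> b # takeWhile (\<lambda>x. x \<le> r) w @ v | [] \<Rightarrow> w)"

text \<open>Inverse to \<open>raise\<close>: \<open>b\<close> returns behind the longest run of
  letters below it. That run is the right one because, in a word without descents, the letter after
  \<open>b\<close> is not below \<open>b\<close>.\<close>

definition lower :: "nat list \<Rightarrow> nat list" where
  "lower w = (case w of b # a # v \<Rightarrow> a # takeWhile (\<lambda>x. x \<prec> b) v @ b # dropWhile (\<lambda>x. x \<prec> b) v | _ \<Rightarrow> w)"

lemma raise_dominated:
  assumes "\<forall>x\<in>set u. x \<prec> b" "u \<noteq> []"
  shows "raise (u @ b # v) = b # u @ v"
proof -
  have "\<forall>x\<in>set u. x \<le> r" "\<not> b \<le> r"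
    using assms P_lessD(2,3)[of _ b] by (auto simp: neq_Nil_conv not_le)
  then show ?thesis by (simp add: raise_def)
qed

text \<open>The letter \<open>b\<close> is comparable to every letter it passes, so it crosses no
  edge.\<close>

lemma inv_perm_move:
  assumes "\<forall>x\<in>set u. x \<prec> b"
  shows "inv_perm (u @ b # v) = inv_perm (b # u @ v)"
proof -
  have "(\<Sum>x\<leftarrow>u. length (filter (\<lambda>y. inc_edge m n y x) [b])) = 0"
    using assms P_less_not_edge by (induction u) auto
  moreover have "filter (\<lambda>y. inc_edge m n y b) u = []"
    using assms P_less_not_edge by (auto simp: filter_empty_conv)
  ultimately have "inv_perm (u @ [b]) = inv_perm (b # u)"
    by (simp add: inv_list_append)
  then show ?thesis
    using inv_list_cong_mset[of "u @ [b]" "b # u" _ "[]" v] by simp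
qed

text \<open>The dominating letter \<open>b\<close>, moved to the front, forms a new row of length
  two with the first letter \<open>a\<close>. What remains has two letters fewer.\<close>

lemma weight_dominated:
  assumes "\<forall>xs\<in>A. length xs = k"
  shows "weight (A \<odot> {w \<in> descent_free (Suc (Suc q)). dominated w}) = weight (A \<odot> pchains 2 \<odot> descent_free q)"
proof -
  let ?s = "successively (\<lambda>x y. \<not> y \<prec> x)"
  have "weight (A \<odot> {w \<in> descent_free (Suc (Suc q)). dominated w} \<odot> {[]}) =
      weight (A \<odot> (pchains 2 \<odot> descent_free q) \<odot> {[]})"
  proof (rule weight_local_bij[where \<phi> = raise and \<psi> = lower and q = "Suc (Suc q)", OF assms])
    show "\<forall>xs\<in>{w \<in> descent_free (Suc (Suc q)). dominated w}. length xs = Suc (Suc q)"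
        "\<forall>xs\<in>pchains 2 \<odot> descent_free q. length xs = Suc (Suc q)"
      by (auto simp: conc_def descent_free_def pchains_def)
  next
    fix w assume "w \<in> {w \<in> descent_free (Suc (Suc q)). dominated w}"
    then obtain u b v where w: "w = u @ b # v" "u \<noteq> []" "\<forall>x\<in>set u. x \<prec> b"
      and "?s w" and l: "length w = Suc (Suc q)"
      by (auto simp: dominated_iff descent_free_def)
    obtain a u' where u: "u = a # u'" using w(2) by (cases u) auto
    have s: "?s (b # v)" and su: "?s u"
      using \<open>?s w\<close> unfolding w by (auto simp: successively_append_iff)
    have "?s (u' @ v)"
    proof -
      \<comment> \<open>Letters of \<open>u'\<close> are below \<open>b\<close>, hence at most
        \<open>r\<close>, and nothing lies below them. Closing the gap left by \<open>b\<close>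
        creates no descent.\<close>
      have "\<not> y \<prec> x" if "x \<in> set u'" for x y
        using w(3) u that P_lessD(2)[of x b] P_lessD(3)[of y x] by auto
      then show ?thesis
        using s su unfolding u by (auto simp: successively_append_iff successively_Cons)
    qed
    moreover have "raise w = [b, a] @ u' @ v"
      using raise_dominated[OF w(3,2)] w(1) u by simp
    moreover have "[b, a] \<in> pchains 2" using w(3) u by (simp add: pchains_2)
    moreover have "length (u' @ v) = q" using l w(1) u by simp
    ultimately have 1: "raise w \<in> pchains 2 \<odot> descent_free q"
      unfolding conc_def descent_free_def by blast
    have tw: "takeWhile (\<lambda>x. x \<prec> b) v = []" "dropWhile (\<lambda>x. x \<prec> b) v = v"
      using s by (cases v; simp)+
    have "lower (raise w) = w"
      using raise_dominated[OF w(3,2), of v] w u tw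
      by (simp add: lower_def)
    then show "raise w \<in> pchains 2 \<odot> descent_free q \<and> lower (raise w) = w \<and>
        mset (raise w) = mset w \<and> inv_perm (raise w) = inv_perm w"
      using 1 raise_dominated[OF w(3,2), of v] inv_perm_move[OF w(3), of v] w(1)
      by simp
  next
    fix w assume "w \<in> pchains 2 \<odot> descent_free q"
    then obtain a b v where w: "w = b # a # v" "a \<prec> b" "?s v" "length v = q"
      by (auto simp: conc_def pchains_2 descent_free_def)
    define u where "u = takeWhile (\<lambda>x. x \<prec> b) v"
    define v' where "v' = dropWhile (\<lambda>x. x \<prec> b) v"
    have v: "v = u @ v'" by (simp add: u_def v'_def)
    have lw: "lower w = (a # u) @ b # v'" by (simp add: lower_def w u_def v'_def)
    have all: "\<forall>x\<in>set (a # u). x \<prec> b"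
      using w(2) by (auto simp: u_def dest: set_takeWhileD)
    have no: "\<not> y \<prec> x" if "x \<in> set (a # u)" for x y
      using all that P_lessD(2)[of x b] P_lessD(3)[of y x] by auto
    have "?s v'" "?s u" using w(3) unfolding v by (auto simp: successively_append_iff)
    \<comment> \<open>Maximality of the run excludes a descent right after the reinserted
      \<open>b\<close>.\<close>
    moreover have "v' = [] \<or> \<not> hd v' \<prec> b"
      unfolding v'_def using hd_dropWhile by blast
    ultimately have "?s (lower w)"
      using no unfolding lw by (auto simp: successively_append_iff successively_Cons)
    moreover have "dominated (lower w)"
      using all unfolding lw dominated_iff by blast
    moreover have "raise (lower w) = w"
      unfolding lw raise_dominated[OF all list.distinct(2)] using w(1) v by simp
    moreover have "mset (lower w) = mset w" "length (lower w) = Suc (Suc q)"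
      unfolding lw using w(1,4) v by auto
    ultimately show "lower w \<in> {w \<in> descent_free (Suc (Suc q)). dominated w} \<and>
        raise (lower w) = w \<and> mset (lower w) = mset w"
      by (simp add: descent_free_def)
  qed
  then show ?thesis by (simp add: conc_assoc)
qed

lemma length_lang_pairs: "\<forall>xs\<in>lang (replicate l (pchains 2)). length xs = 2 * l"
  using length_lang_chains[of _ "replicate l 2"] by (simp add: sum_list_replicate)

text \<open>Words with a forbidden row correspond to words with one more pair. When fewer than two
  letters remain after the pairs, both weights vanish.\<close>

lemma tableau_weight_step:
  assumes "2 * l \<le> n"
  shows "tableau_weight l = bar_weight l + tableau_weight (Suc l)"
proof -
  let ?A = "lang (replicate l (pchains 2))" and ?p = "n - 2 * l"
  let ?D = "{w \<in> descent_free ?p. dominated w}" and ?U = "{w \<in> descent_free ?p. \<not> dominated w}"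
  have "descent_free ?p = ?U \<union> ?D" by auto
  then have "?A \<odot> descent_free ?p = (?A \<odot> ?U) \<union> (?A \<odot> ?D)"
    using conc_Un[of ?A ?U ?D "{[]}"] by simp
  moreover have "(?A \<odot> ?U) \<inter> (?A \<odot> ?D) = {}"
    by (auto simp: conc_fixed_length_iff[OF length_lang_pairs])
  ultimately have "tableau_weight l = bar_weight l + weight (?A \<odot> ?D)"
    by (simp add: tableau_weight_def bar_weight_def weight_union)
  moreover have "weight (?A \<odot> ?D) = tableau_weight (Suc l)"
  proof (cases "2 * Suc l \<le> n")
    case True
    then have p: "?p = Suc (Suc (n - 2 * Suc l))" by simp
    have "lang (replicate (Suc l) (pchains 2)) = ?A \<odot> pchains 2"
      unfolding replicate_Suc replicate_append_same[symmetric] by simp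
    then show ?thesis
      unfolding tableau_weight_def p weight_dominated[OF length_lang_pairs] by (simp add: conc_assoc)
  next
    case False
    have "weight (lang (replicate (Suc l) (pchains 2)) \<odot> descent_free (n - 2 * Suc l)) = 0"
    proof (rule weight_length_neq)
      fix xs assume "xs \<in> lang (replicate (Suc l) (pchains 2)) \<odot> descent_free (n - 2 * Suc l)"
      then show "length xs \<noteq> n"
        using False length_lang_pairs[of "Suc l"] by (auto simp: conc_def[of "lang _"] simp del: replicate_Suc)
    qed
    moreover have "?D = {}"
      using False by (auto simp: descent_free_def dominated_def)
    then have "?A \<odot> ?D = {}"
      unfolding conc_def by blast
    ultimately show ?thesis by (simp add: tableau_weight_def weight_def)
  qed
  ultimately show ?thesis by simp
qed

section \<open>The triangular system and its solution\<close>

lemma tableau_weight_sum: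
  assumes "2 * d \<le> n"
  shows "tableau_weight d = (\<Sum>l = 0..n div 2. smult (of_bool (d \<le> l)) (bar_weight l))"
proof -
  have z: "tableau_weight (Suc (n div 2)) = 0"
    unfolding tableau_weight_def
  proof (rule weight_length_neq)
    fix xs assume "xs \<in> lang (replicate (Suc (n div 2)) (pchains 2)) \<odot> descent_free (n - 2 * Suc (n div 2))"
    then show "length xs \<noteq> n"
      using length_lang_pairs[of "Suc (n div 2)"] by (auto simp: conc_def[of "lang _"] simp del: replicate_Suc)
  qed
  have "d \<le> n div 2" using assms by simp
  then have "tableau_weight d = (\<Sum>l = d..n div 2. bar_weight l)"
  proof (induction rule: inc_induct)
    case base
    then show ?case using tableau_weight_step[of "n div 2"] z by simp
  next
    case (step k)
    then show ?case using tableau_weight_step[of k] by (simp add: sum.atLeast_Suc_atMost)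
  qed
  also have "\<dots> = (\<Sum>l = 0..n div 2. smult (of_bool (d \<le> l)) (bar_weight l))"
    by (rule sum.mono_neutral_cong_left) auto
  finally show ?thesis .
qed

text \<open>Both sides give the same tableau weights under \<open>ribbon_rec\<close>, and both
  vanish for \<open>2 * d > n\<close>. Unitriangularity makes them equal.\<close>

lemma pair_weight_expansion:
  "pair_weight d = (\<Sum>l = 0..n div 2. smult (shifted_binomial n l d) (bar_weight l))"
proof -
  define S where "S d = (\<Sum>l = 0..n div 2. smult (shifted_binomial n l d) (bar_weight l))" for d
  define D where "D d = pair_weight d - S d" for d
  have big: "D d = 0" if "n < 2 * d" for d
  proof -
    have "S d = 0"
      unfolding S_def by (rule sum.neutral) (use that in \<open>auto simp: shifted_binomial_def\<close>)
    then show ?thesis using pair_weight_zero[OF that] by (simp add: D_def)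
  qed
  have "D d = 0" for d
  \<comment> \<open>Downward induction on \<open>d\<close>: once \<open>D\<close> vanishes at all
    larger arguments, \<open>D d\<close> equals its own \<open>ribbon_rec\<close>, a difference of
    equal tableau weights.\<close>
  proof (induction "n - d" arbitrary: d rule: less_induct)
    case less
    show ?case
    proof (cases "n < 2 * d")
      case False
      then have d: "2 * d \<le> n" by simp
      have "D d' = 0" if "d' > d" for d'
      proof (cases "d < n")
        case True
        then show ?thesis using less that by (meson diff_less_mono2)
      next
        case False
        then show ?thesis using that big by simp
      qed
      then have "D d = ribbon_rec D (n - 2 * d) d"
        using ribbon_rec_vanishing(2) by metis
      also have "\<dots> = ribbon_rec pair_weight (n - 2 * d) d - ribbon_rec S (n - 2 * d) d"
        unfolding D_def by (rule ribbon_rec_diff)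
      also have "ribbon_rec S (n - 2 * d) d =
          (\<Sum>l = 0..n div 2. smult (ribbon_rec (shifted_binomial n l) (n - 2 * d) d) (bar_weight l))"
        unfolding S_def by (rule ribbon_rec_sum_smult) simp
      also have "\<dots> = (\<Sum>l = 0..n div 2. smult (of_bool (d \<le> l)) (bar_weight l))"
        using d by (intro sum.cong refl) (simp add: ribbon_rec_binomial)
      finally show ?thesis
        using tableau_weight_ribbon[OF d] tableau_weight_sum[OF d] by simp
    qed (use big in simp)
  qed
  then show ?thesis by (simp add: D_def S_def)
qed

section \<open>Colorings as words\<close>

definition color_row :: "(nat \<Rightarrow> nat) \<Rightarrow> nat \<Rightarrow> nat list" where
  "color_row \<kappa> c = rev (sorted_list_of_set {v \<in> {1..n}. \<kappa> v = c})"

definition color_word :: "nat list \<Rightarrow> (nat \<Rightarrow> nat) \<Rightarrow> nat list" where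
  "color_word cs \<kappa> = concat (map (color_row \<kappa>) cs)"

abbreviation color_order :: "(nat \<Rightarrow> nat) \<Rightarrow> nat \<Rightarrow> nat \<Rightarrow> bool" where
  "color_order \<kappa> x y \<equiv> \<kappa> y < \<kappa> x \<or> (\<kappa> x = \<kappa> y \<and> y < x)"

lemma set_color_row [simp]: "set (color_row \<kappa> c) = {v \<in> {1..n}. \<kappa> v = c}"
  and length_color_row [simp]: "length (color_row \<kappa> c) = card {v \<in> {1..n}. \<kappa> v = c}"
  and sorted_color_row: "sorted_wrt (\<lambda>x y. y < x) (color_row \<kappa> c)"
  by (simp_all add: color_row_def sorted_wrt_rev)

lemma sorted_color_word:
  assumes "sorted_wrt (\<lambda>x y. y < x) cs"
  shows "sorted_wrt (color_order \<kappa>) (color_word cs \<kappa>)"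
  using assms
proof (induction cs)
  case Nil
  then show ?case by (simp add: color_word_def)
next
  case (Cons c cs)
  have "sorted_wrt (color_order \<kappa>) (color_row \<kappa> c)"
    by (rule sorted_wrt_mono_rel[OF _ sorted_color_row]) auto
  then show ?case
    using Cons by (auto simp: color_word_def sorted_wrt_append)
qed

lemma color_row_pchain:
  assumes "proper_coloring {1..n} (inc_edge m n) \<kappa>"
  shows "color_row \<kappa> c \<in> pchains (card {v \<in> {1..n}. \<kappa> v = c})"
proof -
  have "sorted_wrt (\<lambda>x y. y \<prec> x) (color_row \<kappa> c)"
  proof (rule sorted_wrt_mono_rel[OF _ sorted_color_row])
    fix x y assume xy: "x \<in> set (color_row \<kappa> c)" "y \<in> set (color_row \<kappa> c)" "y < x"
    then have "\<not> inc_edge m n y x"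
      using assms by (auto simp: proper_coloring_def)
    then show "y \<prec> x" using xy edge_iff[of y x] by auto
  qed
  then show ?thesis by (simp add: pchains_def)
qed

lemma color_row_eqI:
  assumes "sorted_wrt (\<lambda>x y. y \<prec> x) ys" "{v \<in> {1..n}. \<kappa> v = c} = set ys"
  shows "color_row \<kappa> c = ys"
proof -
  have "sorted_wrt (\<lambda>x y. y < x) ys"
    by (rule sorted_wrt_mono_rel[OF _ assms(1)]) (use P_lessD(5) in blast)
  then have "sorted_wrt (<) (rev ys)" by (simp add: sorted_wrt_rev)
  then have "sorted_list_of_set (set (rev ys)) = rev ys"
    by (intro sorted_list_of_set.idem_if_sorted_distinct) (auto simp: strict_sorted_iff)
  then show ?thesis unfolding color_row_def assms(2) by simp
qed

text \<open>A color class contains no edge, so an edge is inverted only if its larger end has the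
  larger color, which is an ascent.\<close>

lemma inv_color_word:
  assumes "proper_coloring {1..n} (inc_edge m n) \<kappa>" "sorted_wrt (\<lambda>x y. y < x) cs"
    and "set (color_word cs \<kappa>) = {1..n}"
  shows "inv_perm (color_word cs \<kappa>) = asc (inc_edge m n) \<kappa>"
proof -
  have "inv_perm (color_word cs \<kappa>) = card {(u, v). u \<in> set (color_word cs \<kappa>) \<and>
      v \<in> set (color_word cs \<kappa>) \<and> inc_edge m n u v \<and> color_order \<kappa> v u}"
    by (rule inv_list_sorted_wrt[OF sorted_color_word[OF assms(2)]]) auto
  also have "{(u, v). u \<in> set (color_word cs \<kappa>) \<and> v \<in> set (color_word cs \<kappa>) \<and>
      inc_edge m n u v \<and> color_order \<kappa> v u} = {(i, j). inc_edge m n i j \<and> \<kappa> i < \<kappa> j}"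
  proof -
    have "\<kappa> i \<noteq> \<kappa> j" if "inc_edge m n i j" for i j
      using that assms(1) by (auto simp: proper_coloring_def)
    moreover have "i \<in> {1..n} \<and> j \<in> {1..n}" if "inc_edge m n i j" for i j
      using that by (auto simp: inc_edge_def)
    ultimately show ?thesis unfolding assms(3) by fastforce
  qed
  finally show ?thesis by (simp add: asc_def)
qed

lemma chrom_qsym_coeff_weight:
  assumes "\<alpha> 0 = 0" "\<And>c. M \<le> c \<Longrightarrow> \<alpha> c = 0"
  shows "chrom_qsym_coeff {1..n} (inc_edge m n) \<alpha> = weight (lang (map pchains (map \<alpha> (rev [1..<M]))))"
proof -
  define cs where "cs = rev [1..<M]"
  have cs: "distinct cs" "sorted_wrt (\<lambda>x y. y < x) cs" "set cs = {1..<M}"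
    by (auto simp: cs_def sorted_wrt_rev)
  let ?K = "colorings_with_content {1..n} (inc_edge m n) \<alpha>"
  let ?L = "lang (map (\<lambda>c. pchains (\<alpha> c)) cs) \<inter> perms"
  have K: "proper_coloring {1..n} (inc_edge m n) \<kappa>" "\<And>c. card {v \<in> {1..n}. \<kappa> v = c} = \<alpha> c"
    if "\<kappa> \<in> ?K" for \<kappa>
    using that by (auto simp: colorings_with_content_def)
  have Kcs: "\<kappa> v \<in> set cs" if "\<kappa> \<in> ?K" "v \<in> {1..n}" for \<kappa> v
  proof -
    have "v \<in> {v' \<in> {1..n}. \<kappa> v' = \<kappa> v}" using that by simp
    then have "card {v' \<in> {1..n}. \<kappa> v' = \<kappa> v} \<noteq> 0"
      by (subst card_eq_0_iff) auto
    then have "\<alpha> (\<kappa> v) \<noteq> 0" unfolding K(2)[OF that(1)] .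
    then show ?thesis
      using assms unfolding cs by (metis atLeastLessThan_iff less_one not_le)
  qed
  have set_word: "set (color_word cs \<kappa>) = {1..n}" if "\<kappa> \<in> ?K" for \<kappa>
    using Kcs[OF that] by (auto simp: color_word_def)
  have "bij_betw (color_word cs) ?K ?L"
    unfolding bij_betw_def
  proof
    show "inj_on (color_word cs) ?K"
    proof (rule inj_onI)
      fix \<kappa> \<kappa>' assume k: "\<kappa> \<in> ?K" "\<kappa>' \<in> ?K" "color_word cs \<kappa> = color_word cs \<kappa>'"
      \<comment> \<open>Both words are cut at the same places, because the block lengths are
        prescribed by \<open>\<alpha>\<close>.\<close>
      have "map (color_row \<kappa>) cs = map (color_row \<kappa>') cs"
        using k(3) K(2)[OF k(1)] K(2)[OF k(2)] unfolding color_word_def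
        by (subst (asm) concat_eq_concat_iff) (auto simp: zip_map_map zip_same_conv_map)
      then have rows: "color_row \<kappa> c = color_row \<kappa>' c" if "c \<in> set cs" for c
        using that by simp
      show "\<kappa> = \<kappa>'"
      proof (rule PiE_ext)
        show "\<kappa> \<in> {1..n} \<rightarrow>\<^sub>E {1..}" "\<kappa>' \<in> {1..n} \<rightarrow>\<^sub>E {1..}"
          using K(1) k by (auto simp: proper_coloring_def)
        fix v assume v: "v \<in> {1..n}"
        then have "v \<in> set (color_row \<kappa> (\<kappa> v))" by simp
        then have "v \<in> set (color_row \<kappa>' (\<kappa> v))" using rows Kcs[OF k(1) v] by metis
        then show "\<kappa> v = \<kappa>' v" by simp
      qed
    qed
    show "color_word cs ` ?K = ?L"
    proof (intro equalityI subsetI)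
      fix xs assume "xs \<in> color_word cs ` ?K"
      then obtain \<kappa> where k: "\<kappa> \<in> ?K" "xs = color_word cs \<kappa>" by blast
      have "xs \<in> lang (map (\<lambda>c. pchains (\<alpha> c)) cs)"
        unfolding lang_map_iff[OF cs(1)] k(2) color_word_def
        using color_row_pchain[OF K(1)[OF k(1)]] K(2)[OF k(1)] by auto
      moreover have "distinct xs"
      proof -
        have "sorted_wrt (color_order \<kappa>) xs" using sorted_color_word[OF cs(2)] k by simp
        then show ?thesis by (induction xs) auto
      qed
      ultimately show "xs \<in> ?L" using set_word[OF k(1)] k(2) by (simp add: perms_def)
    next
      fix xs assume xs: "xs \<in> ?L"
      then obtain \<rho> where \<rho>: "\<And>c. c \<in> set cs \<Longrightarrow> \<rho> c \<in> pchains (\<alpha> c)" "xs = concat (map \<rho> cs)"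
        unfolding Int_iff lang_map_iff[OF cs(1)] by blast
      have dist: "distinct (concat (map \<rho> cs))" and set: "set (concat (map \<rho> cs)) = {1..n}"
        using xs \<rho>(2) by (auto simp: perms_def)
      have "\<exists>c. c \<in> set cs \<and> v \<in> set (\<rho> c)" if "v \<in> {1..n}" for v
        using that set by auto
      \<comment> \<open>The color of \<open>v\<close> is the index of the block that contains
        it.\<close>
      then obtain f where f: "\<And>v. v \<in> {1..n} \<Longrightarrow> f v \<in> set cs \<and> v \<in> set (\<rho> (f v))" by metis
      define \<kappa> where "\<kappa> = restrict f {1..n}"
      have colclass: "{v \<in> {1..n}. \<kappa> v = c} = set (\<rho> c)" if "c \<in> set cs" for c
      proof (intro equalityI subsetI)
        fix v assume "v \<in> {v \<in> {1..n}. \<kappa> v = c}"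
        then show "v \<in> set (\<rho> c)" using f by (auto simp: \<kappa>_def)
      next
        fix v assume v: "v \<in> set (\<rho> c)"
        then have "v \<in> {1..n}" using set that by auto
        then show "v \<in> {v \<in> {1..n}. \<kappa> v = c}"
          using f distinct_concat_map_unique[OF dist cs(1) _ that _ v, of "f v"] by (simp add: \<kappa>_def)
      qed
      have noclass: "{v \<in> {1..n}. \<kappa> v = c} = {}" if "c \<notin> set cs" for c
        using f that by (auto simp: \<kappa>_def)
      have "card {v \<in> {1..n}. \<kappa> v = c} = \<alpha> c" for c
      proof (cases "c \<in> set cs")
        case True
        then have "distinct (\<rho> c)" using dist by (auto simp: distinct_concat_iff)
        then show ?thesis
          using \<rho>(1)[OF True] by (simp only: colclass[OF True] distinct_card) (simp add: pchains_def)
      next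
        case False
        then have "\<alpha> c = 0" using assms cs(3) by (cases c) auto
        then show ?thesis using noclass[OF False] by simp
      qed
      moreover have "proper_coloring {1..n} (inc_edge m n) \<kappa>"
        unfolding proper_coloring_def
      proof (intro conjI allI impI notI)
        show "\<kappa> \<in> {1..n} \<rightarrow>\<^sub>E {1..}" using f cs(3) by (auto simp: \<kappa>_def)
        fix i j assume e: "inc_edge m n i j" "\<kappa> i = \<kappa> j"
        then have ij: "i \<in> {1..n}" "j \<in> {1..n}" "i \<noteq> j" by (auto simp: inc_edge_def)
        define c where "c = \<kappa> i"
        have c: "c \<in> set cs" using f ij by (auto simp: c_def \<kappa>_def)
        have "i \<in> set (\<rho> c)" "j \<in> set (\<rho> c)"
          using colclass[OF c] ij e(2) c_def by auto
        moreover have "sorted_wrt (\<lambda>x y. y \<prec> x) (\<rho> c)"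
          using \<rho>(1)[OF c] by (simp add: pchains_def)
        ultimately have "i \<prec> j \<or> j \<prec> i"
          using ij(3) by (auto simp: sorted_wrt_iff_nth_less in_set_conv_nth) (metis nat_neq_iff)
        then show False using e(1) P_less_not_edge by blast
      qed
      ultimately have "\<kappa> \<in> ?K" by (simp add: colorings_with_content_def)
      moreover have "color_row \<kappa> c = \<rho> c" if "c \<in> set cs" for c
        by (rule color_row_eqI) (use \<rho>(1)[OF that] colclass[OF that] in \<open>auto simp: pchains_def\<close>)
      then have "color_word cs \<kappa> = xs"
        unfolding color_word_def \<rho>(2) by (metis map_cong)
      ultimately show "xs \<in> color_word cs ` ?K" by blast
    qed
  qed
  then have "weight (lang (map (\<lambda>c. pchains (\<alpha> c)) cs)) = (\<Sum>\<kappa> \<in> ?K. monom 1 (inv_perm (color_word cs \<kappa>)))"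
    unfolding weight_def by (rule sum.reindex_bij_betw[symmetric])
  also have "\<dots> = chrom_qsym_coeff {1..n} (inc_edge m n) \<alpha>"
    unfolding chrom_qsym_coeff_def
    using inv_color_word[OF K(1) cs(2) set_word] by (intro sum.cong refl) simp
  finally show ?thesis by (simp add: cs_def comp_def)
qed

lemma lang_pchains_filter: "lang (map pchains (filter ((\<noteq>) 0) w)) = lang (map pchains w)"
  by (induction w) auto

text \<open>For an exponent with entries at most 2, total \<open>n\<close> and
  \<open>\<alpha> 0 = 0\<close>, the word expansion applies. For any other both sides are 0: colors
  are positive, and there is no three-element chain to fill a class.\<close>

lemma chrom_qsym_coeff_expansion:
  assumes fin: "finite {c. \<alpha> c \<noteq> 0}"
  shows "chrom_qsym_coeff {1..n} (inc_edge m n) \<alpha> =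
    (\<Sum>l = 0..n div 2. smult (int (e_coeff [n - l, l] \<alpha>)) (bar_weight l))"
proof (cases "\<alpha> 0 = 0 \<and> (\<forall>c. \<alpha> c \<le> 2) \<and> (\<Sum>c | \<alpha> c \<noteq> 0. \<alpha> c) = n")
  case good: True
  obtain M where M: "\<And>c. M \<le> c \<Longrightarrow> \<alpha> c = 0"
    using fin unfolding finite_nat_set_iff_bounded by (metis (mono_tags) mem_Collect_eq not_le)
  define w where "w = map \<alpha> (rev [1..<M])"
  have supp: "{c. \<alpha> c \<noteq> 0} \<subseteq> {1..<M}"
  proof
    fix c assume "c \<in> {c. \<alpha> c \<noteq> 0}"
    then have "\<alpha> c \<noteq> 0" by simp
    then have "c \<noteq> 0" "\<not> M \<le> c" using good M by metis+
    then show "c \<in> {1..<M}" by simp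
  qed
  have "sum_list w = (\<Sum>c \<in> {1..<M}. \<alpha> c)"
    unfolding w_def by (subst sum_list_distinct_conv_sum_set) auto
  also have "\<dots> = (\<Sum>c | \<alpha> c \<noteq> 0. \<alpha> c)"
    by (rule sum.mono_neutral_right) (use supp in auto)
  finally have sum: "sum_list w = n" using good by simp
  have "count_list w 2 = length (filter (\<lambda>c. \<alpha> c = 2) (rev [1..<M]))"
    by (simp add: w_def count_list_eq_length_filter filter_map comp_def eq_commute)
  also have "\<dots> = card (set (filter (\<lambda>c. \<alpha> c = 2) (rev [1..<M])))"
    by (rule distinct_card[symmetric]) simp
  also have "set (filter (\<lambda>c. \<alpha> c = 2) (rev [1..<M])) = {c. \<alpha> c = 2}"
    using supp by (fastforce simp: subset_iff)
  finally have cnt: "count_list w 2 = card {c. \<alpha> c = 2}" .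
  let ?w = "filter ((\<noteq>) 0) w"
  have "set ?w \<subseteq> {Suc 0, 2}"
  proof
    fix x assume "x \<in> set ?w"
    then have "x \<noteq> 0" "x \<le> 2" using good by (auto simp: w_def)
    then show "x \<in> {Suc 0, 2}" by auto
  qed
  moreover have "sum_list (filter ((\<noteq>) 0) w') = sum_list w'" for w' :: "nat list"
    by (induction w') auto
  then have "sum_list ?w = n" using sum by simp
  ultimately have "weight (lang (map pchains ?w)) = pair_weight (count_list ?w 2)"
    by (rule weight_word)
  moreover have "count_list (filter ((\<noteq>) 0) w') 2 = count_list w' 2" for w' :: "nat list"
    by (induction w') auto
  ultimately have "weight (lang (map pchains w)) = pair_weight (card {c. \<alpha> c = 2})"
    by (simp only: lang_pchains_filter cnt)
  then have "chrom_qsym_coeff {1..n} (inc_edge m n) \<alpha> = pair_weight (card {c. \<alpha> c = 2})"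
    using chrom_qsym_coeff_weight[of \<alpha> M] good M by (simp add: w_def)
  also have "\<dots> = (\<Sum>l = 0..n div 2. smult (shifted_binomial n l (card {c. \<alpha> c = 2})) (bar_weight l))"
    by (rule pair_weight_expansion)
  also have "\<dots> = (\<Sum>l = 0..n div 2. smult (int (e_coeff [n - l, l] \<alpha>)) (bar_weight l))"
    using good fin by (intro sum.cong refl) (subst e_coeff_binomial, auto)
  finally show ?thesis .
next
  case bad: False
  have "e_coeff [n - l, l] \<alpha> = 0" if "l \<le> n" for l
    using e_coeff_nonzeroD[OF _ that fin] bad by blast
  then have "(\<Sum>l = 0..n div 2. smult (int (e_coeff [n - l, l] \<alpha>)) (bar_weight l)) = 0"
    by (intro sum.neutral) auto
  moreover have "colorings_with_content {1..n} (inc_edge m n) \<alpha> = {}"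
  proof (rule ccontr)
    assume "colorings_with_content {1..n} (inc_edge m n) \<alpha> \<noteq> {}"
    then obtain \<kappa> where k: "proper_coloring {1..n} (inc_edge m n) \<kappa>" "\<And>c. card {v \<in> {1..n}. \<kappa> v = c} = \<alpha> c"
      by (auto simp: colorings_with_content_def)
    have "{v \<in> {1..n}. \<kappa> v = 0} = {}"
      using k(1) by (force simp: proper_coloring_def PiE_iff)
    then have "\<alpha> 0 = 0" using k(2)[of 0] by (simp only: card.empty)
    moreover have "\<alpha> c \<le> 2" for c
    proof (rule ccontr)
      assume "\<not> \<alpha> c \<le> 2"
      then have "pchains (\<alpha> c) = {}" by (intro pchains_ge_3) simp
      then show False using color_row_pchain[OF k(1), of c] k(2) by simp
    qed
    moreover have "(\<Sum>c | \<alpha> c \<noteq> 0. \<alpha> c) = n"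
    proof -
      have "\<alpha> (\<kappa> v) \<noteq> 0" if "v \<in> {1..n}" for v
        using that unfolding k(2)[symmetric] by (subst card_eq_0_iff) auto
      then have "{1..n} = (\<Union>c \<in> {c. \<alpha> c \<noteq> 0}. {v \<in> {1..n}. \<kappa> v = c})"
        by auto
      then have "card {1..n} = card (\<Union>c \<in> {c. \<alpha> c \<noteq> 0}. {v \<in> {1..n}. \<kappa> v = c})"
        by (rule arg_cong)
      also have "\<dots> = (\<Sum>c | \<alpha> c \<noteq> 0. card {v \<in> {1..n}. \<kappa> v = c})"
        by (rule card_UN_disjoint[OF fin]) auto
      finally show ?thesis unfolding k(2) by simp
    qed
    ultimately show False using bad by blast
  qed
  ultimately show ?thesis by (simp add: chrom_qsym_coeff_def)
qed

section \<open>Tableaux as words\<close>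

lemma lang_pairs_iff:
  "xs \<in> lang (replicate l (pchains 2)) \<longleftrightarrow> length xs = 2 * l \<and> (\<forall>i<l. xs ! Suc (2 * i) \<prec> xs ! (2 * i))"
proof (induction l arbitrary: xs)
  case 0
  then show ?case by simp
next
  case (Suc l)
  have len: "\<forall>xs\<in>pchains 2. length xs = 2" by (simp add: pchains_def)
  show ?case
  proof (cases "length xs = 2 * Suc l")
    case True
    then obtain b a ys where xs: "xs = b # a # ys" by (auto simp: length_Suc_conv)
    show ?thesis
      using Suc.IH[of ys] unfolding replicate_Suc lang_Cons conc_fixed_length_iff[OF len] xs
      by (auto simp: pchains_2 All_less_Suc2)
  next
    case False
    then show ?thesis using length_lang_pairs[of "Suc l"] by blast
  qed
qed

lemma bar_language_iff:
  assumes "2 * l \<le> n" "length xs = n"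
  shows "xs \<in> lang (replicate l (pchains 2)) \<odot> {w \<in> descent_free (n - 2 * l). \<not> dominated w} \<longleftrightarrow>
    (\<forall>i<l. xs ! Suc (2 * i) \<prec> xs ! (2 * i)) \<and>
    (\<forall>k. 2 * l \<le> k \<and> Suc k < n \<longrightarrow> \<not> xs ! Suc k \<prec> xs ! k) \<and>
    \<not> (\<exists>s. 2 * l < s \<and> s < n \<and> (\<forall>k. 2 * l \<le> k \<and> k < s \<longrightarrow> xs ! k \<prec> xs ! s))"
proof -
  let ?d = "drop (2 * l) xs"
  have "take (2 * l) xs \<in> lang (replicate l (pchains 2)) \<longleftrightarrow> (\<forall>i<l. xs ! Suc (2 * i) \<prec> xs ! (2 * i))"
    using assms by (auto simp: lang_pairs_iff)
  moreover have "?d \<in> descent_free (n - 2 * l) \<longleftrightarrow> (\<forall>k. 2 * l \<le> k \<and> Suc k < n \<longrightarrow> \<not> xs ! Suc k \<prec> xs ! k)"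
  proof -
    have "?d \<in> descent_free (n - 2 * l) \<longleftrightarrow> (\<forall>k. Suc k < n - 2 * l \<longrightarrow> \<not> xs ! Suc (2 * l + k) \<prec> xs ! (2 * l + k))"
      using assms by (auto simp: descent_free_def successively_conv_nth)
    also have "\<dots> \<longleftrightarrow> (\<forall>k. 2 * l \<le> k \<and> Suc k < n \<longrightarrow> \<not> xs ! Suc k \<prec> xs ! k)"
    proof (intro iffI allI impI)
      fix k assume "\<forall>k. Suc k < n - 2 * l \<longrightarrow> \<not> xs ! Suc (2 * l + k) \<prec> xs ! (2 * l + k)" "2 * l \<le> k \<and> Suc k < n"
      then show "\<not> xs ! Suc k \<prec> xs ! k" by (auto dest!: spec[of _ "k - 2 * l"])
    qed auto
    finally show ?thesis .
  qed
  moreover have "dominated ?d \<longleftrightarrow> (\<exists>s. 2 * l < s \<and> s < n \<and> (\<forall>k. 2 * l \<le> k \<and> k < s \<longrightarrow> xs ! k \<prec> xs ! s))"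
  proof
    assume "dominated ?d"
    then obtain s where s: "1 \<le> s" "s < n - 2 * l" "\<And>i. i < s \<Longrightarrow> xs ! (2 * l + i) \<prec> xs ! (2 * l + s)"
      using assms by (auto simp: dominated_def)
    have "xs ! k \<prec> xs ! (2 * l + s)" if "2 * l \<le> k" "k < 2 * l + s" for k
      using s(3)[of "k - 2 * l"] that by auto
    then show "\<exists>s. 2 * l < s \<and> s < n \<and> (\<forall>k. 2 * l \<le> k \<and> k < s \<longrightarrow> xs ! k \<prec> xs ! s)"
      using s by (intro exI[of _ "2 * l + s"]) auto
  next
    assume "\<exists>s. 2 * l < s \<and> s < n \<and> (\<forall>k. 2 * l \<le> k \<and> k < s \<longrightarrow> xs ! k \<prec> xs ! s)"
    then obtain s where s: "2 * l < s" "s < n" "\<And>k. 2 * l \<le> k \<Longrightarrow> k < s \<Longrightarrow> xs ! k \<prec> xs ! s" by blast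
    then show "dominated ?d"
      using assms unfolding dominated_def by (intro exI[of _ "s - 2 * l"]) auto
  qed
  ultimately show ?thesis
    unfolding conc_fixed_length_iff[OF length_lang_pairs] by blast
qed

lemma fill_cells:
  assumes "2 * l \<le> n"
  shows "i < l \<Longrightarrow> fill n l xs (Suc i, 1) = xs ! Suc (2 * i)"
    and "i < l \<Longrightarrow> fill n l xs (Suc i, 2) = xs ! (2 * i)"
    and "l < i \<Longrightarrow> i \<le> n - l \<Longrightarrow> fill n l xs (i, 1) = xs ! (l + i - 1)"
  using assms by (auto simp: fill_def young_cells_shape_21 cell_pos_def)

text \<open>The column condition is a constraint only between rows of length one. In the first
  column a two-cell row ends in a minimal element above the next row; in the second column the lower
  entry is maximal.\<close>

lemma P_tableau_fill_iff:
  assumes l: "2 * l \<le> n" and xs: "xs \<in> perms"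
  shows "P_tableau m n (shape_21 n l) (fill n l xs) \<longleftrightarrow>
    (\<forall>i<l. xs ! Suc (2 * i) \<prec> xs ! (2 * i)) \<and>
    (\<forall>k. 2 * l \<le> k \<and> Suc k < n \<longrightarrow> \<not> xs ! Suc k \<prec> xs ! k)"
proof -
  let ?Y = "young_cells (shape_21 n l)" and ?T = "fill n l xs"
  note Y = young_cells_shape_21[OF l]
  have len: "length xs = n" using length_perms xs by simp
  have "bij_betw ((!) xs) {..<n} {1..n}"
    using bij_betw_nth[of xs "{..<n}" "{1..n}"] xs len by (simp add: perms_def)
  from bij_betw_trans[OF bij_betw_cell_pos[OF l] this]
  have bij: "bij_betw ?T ?Y {1..n}"
    by (rule bij_betw_cong[THEN iffD1, rotated]) (simp add: fill_def)
  have ext: "?T \<in> ?Y \<rightarrow>\<^sub>E {1..n}"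
    using bij_betwE[OF bij] by (auto simp: fill_def PiE_iff)
  have rows: "(\<forall>i j. (i, j) \<in> ?Y \<and> (i, j + 1) \<in> ?Y \<longrightarrow> ?T (i, j) \<prec> ?T (i, j + 1)) \<longleftrightarrow>
      (\<forall>i<l. xs ! Suc (2 * i) \<prec> xs ! (2 * i))" (is "?R \<longleftrightarrow> ?R'")
  proof
    assume R: ?R
    show ?R'
    proof (intro allI impI)
      fix i assume i: "i < l"
      then have "?T (Suc i, 1) \<prec> ?T (Suc i, 1 + 1)"
        using R by (simp add: Y)
      then show "xs ! Suc (2 * i) \<prec> xs ! (2 * i)"
        using fill_cells[OF l, of i] i by (simp add: numeral_2_eq_2)
    qed
  next
    assume R': ?R'
    show ?R
    proof (intro allI impI)
      fix i j assume "(i, j) \<in> ?Y \<and> (i, j + 1) \<in> ?Y"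
      then have ij: "1 \<le> i" "i \<le> l" "j = 1" unfolding Y by auto
      then obtain i' where "i = Suc i'" "i' < l" by (cases i) auto
      then show "?T (i, j) \<prec> ?T (i, j + 1)"
        using R' fill_cells[OF l, of i'] ij(3) by (simp add: numeral_2_eq_2)
    qed
  qed
  have cols: "(\<forall>i j. (i, j) \<in> ?Y \<and> (i + 1, j) \<in> ?Y \<longrightarrow> \<not> ?T (i + 1, j) \<prec> ?T (i, j)) \<longleftrightarrow>
      (\<forall>k. 2 * l \<le> k \<and> Suc k < n \<longrightarrow> \<not> xs ! Suc k \<prec> xs ! k)" (is "?C \<longleftrightarrow> ?C'") if R': ?R'
  proof
    assume C: ?C
    show ?C'
    proof (intro allI impI)
      fix k assume k: "2 * l \<le> k \<and> Suc k < n"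
      \<comment> \<open>The first \<open>l\<close> rows take up \<open>2 * l\<close> positions, so
        row \<open>i > l\<close> sits at position \<open>l + i - 1\<close>, counted from 0.\<close>
      define i where "i = k + 1 - l"
      have i: "l < i" "i + 1 \<le> n - l" "l + i - 1 = k" "l + (i + 1) - 1 = Suc k"
        using k l by (auto simp: i_def)
      then have "\<not> ?T (i + 1, 1) \<prec> ?T (i, 1)" using C by (auto simp: Y)
      then show "\<not> xs ! Suc k \<prec> xs ! k"
        using fill_cells(3)[OF l, of i xs] fill_cells(3)[OF l, of "i + 1" xs] i by simp
    qed
  next
    assume C': ?C'
    show ?C
    proof (intro allI impI)
      fix i j assume "(i, j) \<in> ?Y \<and> (i + 1, j) \<in> ?Y"
      then consider "1 \<le> i" "i \<le> l" "j = 1" | "1 \<le> i" "i + 1 \<le> l" "j = 2" | "l < i" "i + 1 \<le> n - l" "j = 1"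
        unfolding Y by auto
      then show "\<not> ?T (i + 1, j) \<prec> ?T (i, j)"
      proof cases
        case 1
        then obtain i' where i': "i = Suc i'" "i' < l" by (cases i) auto
        then have "xs ! Suc (2 * i') \<prec> xs ! (2 * i')" using R' by blast
        then have "\<not> y \<prec> xs ! Suc (2 * i')" for y
          using not_P_less_chain by blast
        then show ?thesis using fill_cells(1)[OF l i'(2)] i'(1) 1 by simp
      next
        case 2
        then have "xs ! Suc (2 * i) \<prec> xs ! (2 * i)" using R' by auto
        then have "\<not> xs ! (2 * i) \<prec> y" for y
          using not_P_less_chain by blast
        then show ?thesis using fill_cells(2)[OF l, of i xs] 2 by simp
      next
        case 3
        then have "2 * l \<le> l + i - 1 \<and> Suc (l + i - 1) < n" "Suc (l + i - 1) = l + (i + 1) - 1"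
          by linarith+
        moreover from this have "\<not> xs ! (l + (i + 1) - 1) \<prec> xs ! (l + i - 1)"
          using C' by metis
        ultimately show ?thesis
          using 3 fill_cells(3)[OF l, of i xs] fill_cells(3)[OF l, of "i + 1" xs] by simp
      qed
    qed
  qed
  show ?thesis
    unfolding P_tableau_def rows using cols bij ext by blast
qed

lemma fill_tableaux_bar_iff:
  assumes l: "2 * l \<le> n" and xs: "xs \<in> perms"
  shows "fill n l xs \<in> tableaux_bar m n l \<longleftrightarrow>
    xs \<in> lang (replicate l (pchains 2)) \<odot> {w \<in> descent_free (n - 2 * l). \<not> dominated w}"
proof -
  let ?T = "fill n l xs"
  have len: "length (shape_21 n l) = n - l" using l by (simp add: shape_21_def)
  have "(\<exists>s. l + 2 \<le> s \<and> s \<le> n - l \<and> (\<forall>i \<in> {l + 1..<s}. ?T (i, 1) \<prec> ?T (s, 1))) \<longleftrightarrow>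
      (\<exists>s. 2 * l < s \<and> s < n \<and> (\<forall>k. 2 * l \<le> k \<and> k < s \<longrightarrow> xs ! k \<prec> xs ! s))"
  proof
    assume "\<exists>s. l + 2 \<le> s \<and> s \<le> n - l \<and> (\<forall>i \<in> {l + 1..<s}. ?T (i, 1) \<prec> ?T (s, 1))"
    then obtain s where s: "l + 2 \<le> s" "s \<le> n - l" and T: "\<And>i. i \<in> {l + 1..<s} \<Longrightarrow> ?T (i, 1) \<prec> ?T (s, 1)"
      by blast
    have "xs ! k \<prec> xs ! (l + s - 1)" if k: "2 * l \<le> k" "k < l + s - 1" for k
    proof -
      have "l < k + 1 - l" "k + 1 - l \<le> n - l" "l + (k + 1 - l) - 1 = k"
        using k s by auto
      then show ?thesis
        using T[of "k + 1 - l"] k s fill_cells(3)[OF l, of "k + 1 - l" xs] fill_cells(3)[OF l, of s xs]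
        by simp
    qed
    then show "\<exists>s. 2 * l < s \<and> s < n \<and> (\<forall>k. 2 * l \<le> k \<and> k < s \<longrightarrow> xs ! k \<prec> xs ! s)"
      using s l by (intro exI[of _ "l + s - 1"]) auto
  next
    assume "\<exists>s. 2 * l < s \<and> s < n \<and> (\<forall>k. 2 * l \<le> k \<and> k < s \<longrightarrow> xs ! k \<prec> xs ! s)"
    then obtain s where s: "2 * l < s" "s < n" and T: "\<And>k. 2 * l \<le> k \<Longrightarrow> k < s \<Longrightarrow> xs ! k \<prec> xs ! s"
      by blast
    have "?T (i, 1) \<prec> ?T (s + 1 - l, 1)" if i: "i \<in> {l + 1..<s + 1 - l}" for i
    proof -
      have "2 * l \<le> l + i - 1" "l + i - 1 < s" "l < i" "i \<le> n - l"
        "l < s + 1 - l" "s + 1 - l \<le> n - l" "l + (s + 1 - l) - 1 = s"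
        using i s by (simp_all, linarith+)
      then show ?thesis
        using T[of "l + i - 1"] fill_cells(3)[OF l, of i xs] fill_cells(3)[OF l, of "s + 1 - l" xs]
        by simp
    qed
    then show "\<exists>s. l + 2 \<le> s \<and> s \<le> n - l \<and> (\<forall>i \<in> {l + 1..<s}. ?T (i, 1) \<prec> ?T (s, 1))"
      using s by (intro exI[of _ "s + 1 - l"]) auto
  qed
  then show ?thesis
    unfolding tableaux_bar_def mem_Collect_eq len P_tableau_fill_iff[OF l xs]
      bar_language_iff[OF l length_perms[OF xs]] by blast
qed

lemma reading_perms:
  assumes l: "2 * l \<le> n" and T: "P_tableau m n (shape_21 n l) T"
  shows "reading n l T \<in> perms"
proof -
  have "bij_betw (pos_cell l) {..<n} (young_cells (shape_21 n l))"
    by (rule bij_betw_byWitness[where f' = "cell_pos l"])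
       (use cell_pos[OF l] pos_cell[OF l] in auto)
  moreover have "bij_betw T (young_cells (shape_21 n l)) {1..n}"
    using T by (simp add: P_tableau_def)
  ultimately have bij: "bij_betw (T \<circ> pos_cell l) {..<n} {1..n}" by (rule bij_betw_trans)
  then show ?thesis
    unfolding perms_def reading_def bij_betw_def
    by (auto simp: distinct_map comp_def atLeast0LessThan image_image)
qed

text \<open>Two entries of the same row are comparable, hence not joined by an edge. On edges, the
  order of rows and the order in the word agree.\<close>

lemma inv_G_fill:
  assumes l: "2 * l \<le> n" and xs: "xs \<in> perms" and T: "P_tableau m n (shape_21 n l) (fill n l xs)"
  shows "inv_G m n (shape_21 n l) (fill n l xs) = inv_perm xs"
proof -
  let ?Y = "young_cells (shape_21 n l)" and ?T = "fill n l xs"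
  note Y = young_cells_shape_21[OF l]
  have len: "length xs = n" using length_perms xs by simp
  have rows: "\<And>i. i < l \<Longrightarrow> xs ! Suc (2 * i) \<prec> xs ! (2 * i)"
    using T unfolding P_tableau_fill_iff[OF l xs] by blast
  have "(\<exists>i j i' j'. (i, j) \<in> ?Y \<and> (i', j') \<in> ?Y \<and> ?T (i, j) = u \<and> ?T (i', j') = v \<and> i' < i) \<longleftrightarrow>
      (\<exists>i j. i < j \<and> j < length xs \<and> xs ! i = v \<and> xs ! j = u)" if e: "inc_edge m n u v" for u v
  proof
    assume "\<exists>i j i' j'. (i, j) \<in> ?Y \<and> (i', j') \<in> ?Y \<and> ?T (i, j) = u \<and> ?T (i', j') = v \<and> i' < i"
    then obtain i j i' j' where *: "(i, j) \<in> ?Y" "(i', j') \<in> ?Y" "?T (i, j) = u" "?T (i', j') = v" "i' < i"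
      by blast
    then have "xs ! cell_pos l (i, j) = u" "xs ! cell_pos l (i', j') = v"
      by (simp_all add: fill_def)
    moreover have "cell_pos l (i', j') < cell_pos l (i, j)"
      using *(1,2,5) unfolding Y cell_pos_def by auto
    ultimately show "\<exists>i j. i < j \<and> j < length xs \<and> xs ! i = v \<and> xs ! j = u"
      using cell_pos(1)[OF l *(1)] len by blast
  next
    assume "\<exists>i j. i < j \<and> j < length xs \<and> xs ! i = v \<and> xs ! j = u"
    then obtain k k' where k: "k' < k" "k < n" "xs ! k' = v" "xs ! k = u" using len by blast
    obtain i j i' j' where c: "pos_cell l k = (i, j)" "pos_cell l k' = (i', j')" by (metis surj_pair)
    have Yk: "(i, j) \<in> ?Y" "(i', j') \<in> ?Y" "?T (i, j) = u" "?T (i', j') = v"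
      using pos_cell[OF l, of k] pos_cell[OF l, of k'] k c by (auto simp: fill_def)
    have "i' < i"
    proof (rule ccontr)
      assume "\<not> i' < i"
      \<comment> \<open>A later position that is not in a lower row must be the odd half of the same
        two-cell row.\<close>
      then have "k < 2 * l" "k = Suc (2 * (k' div 2))" "k' = 2 * (k' div 2)"
        using c k(1) by (auto simp: pos_cell_def split: if_splits)
      then have "u \<prec> v" using rows[of "k' div 2"] k by auto
      then show False using e P_less_not_edge by blast
    qed
    then show "\<exists>i j i' j'. (i, j) \<in> ?Y \<and> (i', j') \<in> ?Y \<and> ?T (i, j) = u \<and> ?T (i', j') = v \<and> i' < i"
      using Yk by blast
  qed
  then have "{(u, v). inc_edge m n u v \<and>
      (\<exists>i j i' j'. (i, j) \<in> ?Y \<and> (i', j') \<in> ?Y \<and> ?T (i, j) = u \<and> ?T (i', j') = v \<and> i' < i)} =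
      {(u, v). inc_edge m n u v \<and> (\<exists>i j. i < j \<and> j < length xs \<and> xs ! i = v \<and> xs ! j = u)}"
    by blast
  moreover have "distinct xs" using xs by (simp add: perms_def)
  ultimately show ?thesis
    unfolding inv_G_def by (simp only: inv_list_distinct)
qed

lemma C_coeff_bar_weight:
  assumes l: "2 * l \<le> n"
  shows "C_coeff m n l = bar_weight l"
  unfolding C_coeff_def bar_weight_def weight_def
proof (rule sum.reindex_bij_witness[where i = "fill n l" and j = "reading n l"])
  fix T assume T: "T \<in> tableaux_bar m n l"
  then have P: "P_tableau m n (shape_21 n l) T" by (simp add: tableaux_bar_def)
  then show fr: "fill n l (reading n l T) = T"
    by (intro fill_reading[OF l]) (auto simp: P_tableau_def PiE_def)
  note perm = reading_perms[OF l P]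
  show "reading n l T \<in> lang (replicate l (pchains 2)) \<odot> {w \<in> descent_free (n - 2 * l). \<not> dominated w} \<inter> perms"
    using fill_tableaux_bar_iff[OF l perm] T perm fr by simp
  show "monom 1 (inv_perm (reading n l T)) = monom 1 (inv_G m n (shape_21 n l) T)"
    using inv_G_fill[OF l perm] fr P by simp
next
  fix xs assume "xs \<in> lang (replicate l (pchains 2)) \<odot> {w \<in> descent_free (n - 2 * l). \<not> dominated w} \<inter> perms"
  then show "reading n l (fill n l xs) = xs" "fill n l xs \<in> tableaux_bar m n l"
    using reading_fill[OF l length_perms] fill_tableaux_bar_iff[OF l] by auto
qed

end

theorem theorem3p3:
  fixes m :: "nat \<Rightarrow> nat" and n r :: nat
  assumes nuio: "\<forall>i \<in> {1..n - 1}. i \<le> m i \<and> m i \<le> n"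
    and mono: "\<forall>i j. 1 \<le> i \<and> i \<le> j \<and> j \<le> n - 1 \<longrightarrow> m i \<le> m j"
    and m1: "m 1 = r" and rn: "r < n" and mr: "m (r + 1) = n"
  shows "\<exists>k > 0.
     (\<forall>\<alpha> :: nat \<Rightarrow> nat. finite {c. \<alpha> c \<noteq> 0} \<longrightarrow>
        chrom_qsym_coeff {1..n} (inc_edge m n) \<alpha> =
          (\<Sum>l = 0..k. smult (int (e_coeff [n - l, l] \<alpha>)) (C_coeff m n l))) \<and>
     (\<forall>l \<le> k. \<forall>d. coeff (C_coeff m n l) d \<ge> 0)"
proof -
  interpret bipartite_nuio m n r
    using assms by unfold_locales
  \<comment> \<open>This secures \<open>n \<ge> 2\<close>, so that \<open>k = n div 2\<close>, the
    largest possible number of rows of length two, is positive.\<close>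
  have "r \<noteq> 0"
  proof
    assume "r = 0"
    then have "n = 1 \<or> 1 \<le> m 1" using nuio rn by force
    then show False using m1 mr \<open>r = 0\<close> rn by auto
  qed
  then have "n div 2 > 0" using rn by linarith
  moreover have "chrom_qsym_coeff {1..n} (inc_edge m n) \<alpha> =
      (\<Sum>l = 0..n div 2. smult (int (e_coeff [n - l, l] \<alpha>)) (C_coeff m n l))"
    if "finite {c. \<alpha> c \<noteq> 0}" for \<alpha>
    unfolding chrom_qsym_coeff_expansion[OF that]
    by (intro sum.cong refl) (simp add: C_coeff_bar_weight)
  moreover have "coeff (C_coeff m n l) d \<ge> 0" for l d
    unfolding C_coeff_def coeff_sum by (intro sum_nonneg) simp
  ultimately show ?thesis by blast
qed

end
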